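(* For a prime $p$, we have $$\mathfrak{grtmd}_{(\bar1,1)}(p,\mathbf k)=\mathfrak{grtm}_{(\bar1,1)}(p,\mathbf k),$$ $$\mathrm{GRTMD}_{(\bar1,1)}(p,\mathbf k)=\mathrm{GRTM}_{(\bar1,1)}(p,\mathbf k),$$ $$\mathrm{Psdist}_{(\bar1,1)}(p,\mathbf k)=\mathrm{Pseudo}_{(\bar1,1)}(p,\mathbf k).$$
   Context: Let $\mathbf k$ be a field of characteristic $0$ and $N\geqslant1$. **Lie algebras.** For $n\geqslant2$, $\mathfrak t_{n,N}$ is the completed (with respect to the grading where generators have degree 1) $\mathbf k$-Lie algebra with generators $t^{1i}$ ($2\leqslant i\leqslant n$) and $t(a)^{ij}$ ($i\ne j$, $2\leqslant i,j\leqslant n$, $a\in\mathbf Z/N\mathbf Z$) and relations, for all $a,b\in\mathbf Z/N\mathbf Z$ and all distinct $i,j,k,l\in\{2,\dots,n\}$: $t(a)^{ij}=t(-a)^{ji}$; $[t(a)^{ij},t(a+b)^{ik}+t(b)^{jk}]=0$; $[t^{1i}+t^{1j}+\sum_c t(c)^{ij},t(a)^{ij}]=0$; $[t^{1i},t^{1j}+\sum_c t(c)^{ij}]=0$; $[t^{1i},t(a)^{jk}]=0$; $[t(a)^{ij},t(b)^{kl}]=0$ (sums over $c\in\mathbf Z/N\mathbf Z$, here and below). $\mathfrak t^0_{n,N}\subset\mathfrak t_{n,N}$ is the (completed) Lie subalgebra generated by these generators except $t^{1n}$. For $N=1$ write $\mathfrak t^0_n=\mathfrak t^0_{n,1}$,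 $t^{ij}=t(0)^{ij}$. $\mathfrak t^0_3$ is completed free on $A=t^{12},B=B(0)=t^{23}$; $\mathfrak t^0_{3,N}$ is completed free on $A=t^{12}$, $B(a)=t(a)^{23}$ ($a\in\mathbf Z/N\mathbf Z$). $\exp\mathfrak g$ is the group of group-like elements in the completed enveloping algebra of $\mathfrak g$; $\mathrm{Ad}(u)(x)=uxu^{-1}$. $x(X,Y)$ is the image of $x$ under $A\mapsto X,B\mapsto Y$; for $x$ in $\mathfrak t^0_{3,N}$ or $\exp\mathfrak t^0_{3,N}$, $x(X\,|\,Y_i)$ is the image under $A\mapsto X$, $B(i)\mapsto Y_i$ ($i\in\mathbf Z/N\mathbf Z$). $c_W$ is the coefficient of the noncommutative monomial $W$. Put $C=-A-B$ in $\mathfrak t^0_3$ and $C=-A-\sum_aB(a)$ in $\mathfrak t^0_{3,N}$. **Case of $\mathfrak t^0_3$.** $\mathfrak{grt}_1(\mathbf k)$: all $\varphi\in\mathfrak t^0_3$ with $\varphi(A,B)+\varphi(B,A)=0$, $\varphi(A,B)+\varphi(B,C)+\varphi(C,A)=0$, $[B,\varphi(A,B)]+[C,\varphi(A,C)]=0$ and, in $\mathfrak t^0_4$, $\varphi(t^{12},t^{23}+t^{24})+\varphi(t^{13}+t^{23},t^{34})=\varphi(t^{23},t^{34})+\varphi(t^{12}+t^{13},t^{24}+t^{34})+\varphi(t^{12},t^{23})$. The pentagon for $g\in\exp\mathfrak t^0_3$ is $g(t^{12},t^{23}+t^{24})g(t^{13}+t^{23},t^{34})=g(t^{23},t^{34})g(t^{12}+t^{13},t^{24}+t^{34})g(t^{12},t^{23})$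 in $\exp\mathfrak t^0_4$. $\mathrm{GRT}_1(\mathbf k)$: all $g\in\exp\mathfrak t^0_3$ satisfying the pentagon, $g(A,B)g(B,A)=1$, $g(C,A)g(B,C)g(A,B)=1$, $A+g(A,B)^{-1}Bg(A,B)+g(A,C)^{-1}Cg(A,C)=0$. $\mathrm M_1(\mathbf k)$: all $g\in\exp\mathfrak t^0_3$ satisfying the pentagon, $g(A,B)g(B,A)=1$, $e^{A/2}g(C,A)e^{C/2}g(B,C)e^{B/2}g(A,B)=1$. **Cyclotomic case.** $\mathfrak{grtm}_{(\bar1,1)}(N,\mathbf k)$: all $(\varphi,\psi)\in\mathfrak t^0_3\times\mathfrak t^0_{3,N}$ with $\varphi\in\mathfrak{grt}_1(\mathbf k)$, $c_{B(0)}(\psi)=0$ and - mixed pentagon in $\mathfrak t^0_{4,N}$: $\psi(t^{12}|t(a)^{23}+t(a)^{24})+\psi(t^{13}+\sum_ct(c)^{23}|t(a)^{34})=\varphi(t(0)^{23},t(0)^{34})+\psi(t^{12}+t^{13}+\sum_ct(c)^{23}|t(a)^{24}+t(a)^{34})+\psi(t^{12}|t(a)^{23})$; - octagon: $\psi(A|B(i))-\psi(A|B(i+1))+\psi(C|B(1-i))-\psi(C|B(-i))=0$; - special derivation condition: $\sum_{a}[\psi(A|B(a+i)),B(a)]+[\psi(A|B(i))-\psi(C|B(-i)),C]=0$. For $(g,h)\in\exp\mathfrak t^0_3\times\exp\mathfrak t^0_{3,N}$ the group mixed pentagon in $\exp\mathfrak t^0_{4,N}$ is $h(t^{12}|t(a)^{23}+t(a)^{24})\,h(t^{13}+\sum_ct(c)^{23}|t(a)^{34})=g(t(0)^{23},t(0)^{34})\,h(t^{12}+t^{13}+\sum_ct(c)^{23}|t(a)^{24}+t(a)^{34})\,h(t^{12}|t(a)^{23})$.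 $\mathrm{GRTM}_{(\bar1,1)}(N,\mathbf k)$: all $(g,h)$ with $g\in\mathrm{GRT}_1(\mathbf k)$, $c_{B(0)}(h)=0$, the group mixed pentagon, $h(A|B(i+1))^{-1}h(C|B(1-i))h(C|B(-i))^{-1}h(A|B(i))=1$, and $A+\sum_{a}\mathrm{Ad}(h(A|B(a+i))^{-1})(B(a))+\mathrm{Ad}(h(A|B(i))^{-1}h(C|B(-i)))(C)=0$. $\mathrm{Pseudo}_{(\bar1,1)}(N,\mathbf k)$: all $(g,h)$ with $g\in\mathrm M_1(\mathbf k)$, $c_{B(0)}(h)=0$, the group mixed pentagon, and $h(A|B(i+1))^{-1}e^{B(1)/2}h(C|B(1-i))e^{C/N}h(C|B(-i))^{-1}e^{B(0)/2}h(A|B(i))e^{A/N}=1$. **Distribution.** For $N'|N$, $d=N/N'$, let $\pi_{NN'},\delta_{NN'}:\mathfrak t^0_{3,N}\to\mathfrak t^0_{3,N'}$ be given by $\pi_{NN'}:A\mapsto dA$, $B(a)\mapsto B(\bar a)$ ($\bar a$ = image of $a$ in $\mathbf Z/N'\mathbf Z$), $\delta_{NN'}:A\mapsto A$, $B(a)\mapsto B(a/d)$ if $d|a$, $B(a)\mapsto0$ otherwise; also denote by these symbols the induced maps on group-like elements, and $\rho_{NN'}(x)=c_{B(0)}(\pi_{NN'}(x))-c_{B(0)}(x)$. $\mathfrak{grtmd}_{(\bar1,1)}(N,\mathbf k)$ is the set of $(\varphi,\psi)\in\mathfrak{grtm}_{(\bar1,1)}(N,\mathbf k)$ with $(\pi_{NN'}-\delta_{NN'})(\psi)=\rho_{NN'}(\psi)B(0)$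 for all $N'|N$. $\mathrm{GRTMD}_{(\bar1,1)}(N,\mathbf k)$ (resp. $\mathrm{Psdist}_{(\bar1,1)}(N,\mathbf k)$) is the set of $(g,h)$ in $\mathrm{GRTM}_{(\bar1,1)}(N,\mathbf k)$ (resp. $\mathrm{Pseudo}_{(\bar1,1)}(N,\mathbf k)$) with $\pi_{NN'}(h)=e^{\rho_{NN'}(h)B(0)}\delta_{NN'}(h)$ for all $N'|N$. *)

theory Defs
  imports Complex_Main "HOL-Computational_Algebra.Primes"
begin

section \<open>Noncommutative formal power series\<close>

typedef (overloaded) ('x, 'k) ncfps = "UNIV :: ('x list \<Rightarrow> 'k) set"
  morphisms nc_coeff Abs_ncfps ..

setup_lifting type_definition_ncfps

lemma ncfps_eqI: "(\<And>w. nc_coeff f w = nc_coeff g w) \<Longrightarrow> f = g"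
  by (simp add: nc_coeff_inject[symmetric] fun_eq_iff)

lemma sum_triangle_reindex:
  fixes f :: "nat \<Rightarrow> nat \<Rightarrow> 'a :: comm_monoid_add"
  shows "(\<Sum>i\<le>n. \<Sum>j\<le>i. f j (i - j)) = (\<Sum>i\<le>n. \<Sum>j\<le>n - i. f i j)"
  unfolding sum.Sigma[OF finite_atMost ballI[OF finite_atMost]]
  by (rule sum.reindex_bij_witness[where i = "\<lambda>(i, j). (i + j, i)" and j = "\<lambda>(i, j). (j, i - j)"])
     auto

instantiation ncfps :: (type, ring_1) ring_1
begin

lift_definition zero_ncfps :: "('a, 'b) ncfps" is "\<lambda>_. 0" .

lift_definition one_ncfps :: "('a, 'b) ncfps" is "\<lambda>w. if w = [] then 1 else 0" .

lift_definition plus_ncfps :: "('a, 'b) ncfps \<Rightarrow> ('a, 'b) ncfps \<Rightarrow> ('a, 'b) ncfps"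
  is "\<lambda>f g w. f w + g w" .

lift_definition minus_ncfps :: "('a, 'b) ncfps \<Rightarrow> ('a, 'b) ncfps \<Rightarrow> ('a, 'b) ncfps"
  is "\<lambda>f g w. f w - g w" .

lift_definition uminus_ncfps :: "('a, 'b) ncfps \<Rightarrow> ('a, 'b) ncfps"
  is "\<lambda>f w. - f w" .

lift_definition times_ncfps :: "('a, 'b) ncfps \<Rightarrow> ('a, 'b) ncfps \<Rightarrow> ('a, 'b) ncfps"
  is "\<lambda>f g w. \<Sum>i\<le>length w. f (take i w) * g (drop i w)" .

instance
proof
  fix f g h :: "('a, 'b) ncfps"
  show "f * g * h = f * (g * h)"
  proof (rule ncfps_eqI)
    fix w :: "'a list"
    let ?t = "\<lambda>i j. nc_coeff f (take i w) * nc_coeff g (take j (drop i w))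
                 * nc_coeff h (drop (i + j) w)"
    have "nc_coeff (f * g * h) w = (\<Sum>i\<le>length w. \<Sum>j\<le>i. ?t j (i - j))"
      by (auto simp: times_ncfps.rep_eq sum_distrib_right drop_take min_def intro!: sum.cong)
    also have "\<dots> = (\<Sum>i\<le>length w. \<Sum>j\<le>length w - i. ?t i j)"
      by (rule sum_triangle_reindex)
    also have "\<dots> = nc_coeff (f * (g * h)) w"
      by (auto simp: times_ncfps.rep_eq sum_distrib_left mult.assoc add.commute intro!: sum.cong)
    finally show "nc_coeff (f * g * h) w = nc_coeff (f * (g * h)) w" .
  qed
  show "1 * f = f"
  proof (rule ncfps_eqI)
    fix w :: "'a list"
    have "nc_coeff (1 * f) w = (\<Sum>i\<le>length w. if i = 0 then nc_coeff f (drop i w) else 0)"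
      unfolding times_ncfps.rep_eq by (rule sum.cong) (auto simp: one_ncfps.rep_eq)
    then show "nc_coeff (1 * f) w = nc_coeff f w" by simp
  qed
  show "f * 1 = f"
  proof (rule ncfps_eqI)
    fix w :: "'a list"
    have "nc_coeff (f * 1) w = (\<Sum>i\<le>length w. if i = length w then nc_coeff f (take i w) else 0)"
      unfolding times_ncfps.rep_eq by (rule sum.cong) (auto simp: one_ncfps.rep_eq)
    then show "nc_coeff (f * 1) w = nc_coeff f w" by simp
  qed
  show "(f + g) * h = f * h + g * h"
    by transfer (simp add: fun_eq_iff distrib_right sum.distrib)
  show "f * (g + h) = f * g + f * h"
    by transfer (simp add: fun_eq_iff distrib_left sum.distrib)
  show "(0 :: ('a, 'b) ncfps) \<noteq> 1"
    by transfer (auto simp: fun_eq_iff)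
qed (transfer; simp add: fun_eq_iff algebra_simps)+

end

lift_definition nc_letter :: "'x \<Rightarrow> ('x, 'k :: ring_1) ncfps"
  is "\<lambda>x w. if w = [x] then 1 else 0" .

lift_definition nc_smul :: "'k :: ring_1 \<Rightarrow> ('x, 'k) ncfps \<Rightarrow> ('x, 'k) ncfps" (infixr "\<cdot>" 75)
  is "\<lambda>c f w. c * f w" .

lift_definition nc_hom :: "nat \<Rightarrow> ('x, 'k :: ring_1) ncfps \<Rightarrow> ('x, 'k) ncfps"
  is "\<lambda>n f w. if length w = n then f w else 0" .

text \<open>
  Image of \<open>f\<close>, a series in the finite alphabet \<open>X\<close>, under the continuous algebra morphism
  \<open>x \<mapsto> s x\<close>. The series \<open>s x\<close> must have zero constant term, so that only words \<open>v\<close> with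
  \<open>length v \<le> length w\<close> contribute to the coefficient of \<open>w\<close>.
\<close>

lift_definition nc_subst ::
  "'x set \<Rightarrow> ('x \<Rightarrow> ('y, 'k :: ring_1) ncfps) \<Rightarrow> ('x, 'k) ncfps \<Rightarrow> ('y, 'k) ncfps"
  is "\<lambda>X s f w. \<Sum>v | set v \<subseteq> X \<and> length v \<le> length w.
        f v * nc_coeff (prod_list (map s v)) w" .

text \<open>Meaningful for zero constant term, so that \<open>f ^ n\<close> has no words shorter than \<open>n\<close>.\<close>

definition nc_exp :: "('x, 'k :: field_char_0) ncfps \<Rightarrow> ('x, 'k) ncfps" where
  "nc_exp f = Abs_ncfps (\<lambda>w. \<Sum>n\<le>length w. nc_coeff (f ^ n) w / fact n)"

definition nc_inv :: "('x, 'k :: ring_1) ncfps \<Rightarrow> ('x, 'k) ncfps" where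
  "nc_inv f = (THE g. f * g = 1 \<and> g * f = 1)"

definition Ad :: "('x, 'k :: ring_1) ncfps \<Rightarrow> ('x, 'k) ncfps \<Rightarrow> ('x, 'k) ncfps" where
  "Ad u x = u * x * nc_inv u"

definition lie :: "'a :: ring \<Rightarrow> 'a \<Rightarrow> 'a" where
  "lie x y = x * y - y * x"


section \<open>Completed free Lie algebras, group-like elements, quotients\<close>

text \<open>The free Lie algebra on \<open>X\<close>, realised inside the free associative algebra on \<open>X\<close>.\<close>

inductive_set free_lie :: "'x set \<Rightarrow> ('x, 'k :: field_char_0) ncfps set" for X where
  letter: "x \<in> X \<Longrightarrow> nc_letter x \<in> free_lie X"
| zero: "0 \<in> free_lie X"
| add: "f \<in> free_lie X \<Longrightarrow> g \<in> free_lie X \<Longrightarrow> f + g \<in> free_lie X"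
| smul: "f \<in> free_lie X \<Longrightarrow> c \<cdot> f \<in> free_lie X"
| lie: "f \<in> free_lie X \<Longrightarrow> g \<in> free_lie X \<Longrightarrow> lie f g \<in> free_lie X"

text \<open>Completion with respect to the degree: the product of the homogeneous components.\<close>

definition completion :: "('x, 'k :: ring_1) ncfps set \<Rightarrow> ('x, 'k) ncfps set" where
  "completion V = {f. \<forall>m. nc_hom m f \<in> V}"

text \<open>
  Coefficient of \<open>u \<otimes> v\<close> in the coproduct of \<open>f\<close> for which all letters are primitive, i.e.
  a word \<open>w\<close> is sent to the sum of \<open>nths w S \<otimes> nths w (- S)\<close> over all sets \<open>S\<close> of positions of \<open>w\<close>.
\<close>

definition nc_coprod :: "('x, 'k :: ring_1) ncfps \<Rightarrow> 'x list \<Rightarrow> 'x list \<Rightarrow> 'k" where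
  "nc_coprod f u v =
     (\<Sum>w\<in>shuffles u v.
        of_nat (card {S. S \<subseteq> {..<length w} \<and> nths w S = u \<and> nths w (- S) = v}) * nc_coeff f w)"

text \<open>
  Group-like elements of the algebra of series in the alphabet \<open>X\<close>, which is the completed
  enveloping algebra of \<open>completion (free_lie X)\<close>.
\<close>

definition grouplike :: "'x set \<Rightarrow> ('x, 'k :: field_char_0) ncfps set" where
  "grouplike X = {g. (\<forall>w. nc_coeff g w \<noteq> 0 \<longrightarrow> set w \<subseteq> X) \<and> nc_coeff g [] = 1 \<and>
     (\<forall>u v. nc_coprod g u v = nc_coeff g u * nc_coeff g v)}"

text \<open>Lie ideal of \<open>free_lie X\<close> generated by a set \<open>R\<close> of Lie polynomials.\<close>

inductive_set lie_ideal ::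
  "'x set \<Rightarrow> ('x, 'k :: field_char_0) ncfps set \<Rightarrow> ('x, 'k) ncfps set" for X R where
  base: "r \<in> R \<Longrightarrow> r \<in> lie_ideal X R"
| zero: "0 \<in> lie_ideal X R"
| add: "f \<in> lie_ideal X R \<Longrightarrow> g \<in> lie_ideal X R \<Longrightarrow> f + g \<in> lie_ideal X R"
| smul: "f \<in> lie_ideal X R \<Longrightarrow> c \<cdot> f \<in> lie_ideal X R"
| lie: "h \<in> free_lie X \<Longrightarrow> f \<in> lie_ideal X R \<Longrightarrow> lie h f \<in> lie_ideal X R"

text \<open>The free associative algebra on \<open>X\<close>, and its two-sided ideal generated by \<open>R\<close>.\<close>

definition nc_poly :: "'x set \<Rightarrow> ('x, 'k :: ring_1) ncfps set" where
  "nc_poly X = {f. finite {w. nc_coeff f w \<noteq> 0} \<and> (\<forall>w. nc_coeff f w \<noteq> 0 \<longrightarrow> set w \<subseteq> X)}"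

inductive_set assoc_ideal ::
  "'x set \<Rightarrow> ('x, 'k :: field_char_0) ncfps set \<Rightarrow> ('x, 'k) ncfps set" for X R where
  base: "r \<in> R \<Longrightarrow> r \<in> assoc_ideal X R"
| zero: "0 \<in> assoc_ideal X R"
| add: "f \<in> assoc_ideal X R \<Longrightarrow> g \<in> assoc_ideal X R \<Longrightarrow> f + g \<in> assoc_ideal X R"
| left: "h \<in> nc_poly X \<Longrightarrow> f \<in> assoc_ideal X R \<Longrightarrow> h * f \<in> assoc_ideal X R"
| right: "h \<in> nc_poly X \<Longrightarrow> f \<in> assoc_ideal X R \<Longrightarrow> f * h \<in> assoc_ideal X R"


section \<open>The Lie algebras \<open>t\<^sub>n\<^sub>,\<^sub>N\<close>\<close>

text \<open>
  Residue classes modulo \<open>N\<close> are represented by the integers \<open>0, \<dots>, N - 1\<close>.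
  \<open>T1 i\<close> stands for \<open>t\<^sup>1\<^sup>i\<close> and \<open>T a i j\<close> for \<open>t(a)\<^sup>i\<^sup>j\<close>.
\<close>

datatype tgen = T1 nat | T int nat nat

definition tgens :: "nat \<Rightarrow> nat \<Rightarrow> tgen set" where
  "tgens n N = {T1 i | i. i \<in> {2..n}} \<union>
     {T a i j | a i j. a \<in> {0..<int N} \<and> i \<in> {2..n} \<and> j \<in> {2..n} \<and> i \<noteq> j}"

definition t1 :: "nat \<Rightarrow> (tgen, 'k :: field_char_0) ncfps" where
  "t1 i = nc_letter (T1 i)"

definition tij :: "nat \<Rightarrow> int \<Rightarrow> nat \<Rightarrow> nat \<Rightarrow> (tgen, 'k :: field_char_0) ncfps" where
  "tij N a i j = nc_letter (T (a mod int N) i j)"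

definition tsum :: "nat \<Rightarrow> nat \<Rightarrow> nat \<Rightarrow> (tgen, 'k :: field_char_0) ncfps" where
  "tsum N i j = (\<Sum>c = 0..<int N. tij N c i j)"

definition trels :: "nat \<Rightarrow> nat \<Rightarrow> (tgen, 'k :: field_char_0) ncfps set" where
  "trels n N =
     {tij N a i j - tij N (- a) j i | a i j. {i, j} \<subseteq> {2..n} \<and> distinct [i, j]} \<union>
     {lie (tij N a i j) (tij N (a + b) i k + tij N b j k) | a b i j k.
        {i, j, k} \<subseteq> {2..n} \<and> distinct [i, j, k]} \<union>
     {lie (t1 i + t1 j + tsum N i j) (tij N a i j) | a i j. {i, j} \<subseteq> {2..n} \<and> distinct [i, j]} \<union>
     {lie (t1 i) (t1 j + tsum N i j) | i j. {i, j} \<subseteq> {2..n} \<and> distinct [i, j]} \<union>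
     {lie (t1 i) (tij N a j k) | a i j k. {i, j, k} \<subseteq> {2..n} \<and> distinct [i, j, k]} \<union>
     {lie (tij N a i j) (tij N b k l) | a b i j k l.
        {i, j, k, l} \<subseteq> {2..n} \<and> distinct [i, j, k, l]}"

text \<open>
  Equality in \<open>t\<^sub>n\<^sub>,\<^sub>N\<close>, the quotient of \<open>completion (free_lie (tgens n N))\<close> by the closed Lie ideal
  generated by the relations (which are homogeneous). This is also equality in the Lie subalgebra
  \<open>t\<^sup>0\<^sub>n\<^sub>,\<^sub>N\<close>.
\<close>

definition t_eq :: "nat \<Rightarrow> nat \<Rightarrow> (tgen, 'k :: field_char_0) ncfps \<Rightarrow> (tgen, 'k) ncfps \<Rightarrow> bool" where
  "t_eq n N f g \<longleftrightarrow> f - g \<in> completion (lie_ideal (tgens n N) (trels n N))"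

text \<open>
  Equality in the completed enveloping algebra of \<open>t\<^sub>n\<^sub>,\<^sub>N\<close>, i.e. in the completed associative algebra
  with the same generators and relations. By Poincare-Birkhoff-Witt, the completed enveloping
  algebra of \<open>t\<^sup>0\<^sub>n\<^sub>,\<^sub>N\<close>, hence \<open>exp t\<^sup>0\<^sub>n\<^sub>,\<^sub>N\<close>, embeds into it.
\<close>

definition Ut_eq :: "nat \<Rightarrow> nat \<Rightarrow> (tgen, 'k :: field_char_0) ncfps \<Rightarrow> (tgen, 'k) ncfps \<Rightarrow> bool" where
  "Ut_eq n N f g \<longleftrightarrow> f - g \<in> completion (assoc_ideal (tgens n N) (trels n N))"

text \<open>
  The completed free Lie algebra \<open>t\<^sup>0\<^sub>3\<^sub>,\<^sub>N\<close> on \<open>A\<close> and \<open>B(a)\<close>, with \<open>t\<^sup>0\<^sub>3\<close> being the case \<open>N = 1\<close>,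
  \<open>B = B(0)\<close>.
\<close>

datatype gen3 = LA | LB int

definition gens3 :: "nat \<Rightarrow> gen3 set" where
  "gens3 N = insert LA (LB ` {0..<int N})"

definition t03 :: "nat \<Rightarrow> (gen3, 'k :: field_char_0) ncfps set" where
  "t03 N = completion (free_lie (gens3 N))"

definition Exp_t03 :: "nat \<Rightarrow> (gen3, 'k :: field_char_0) ncfps set" where
  "Exp_t03 N = grouplike (gens3 N)"

definition gA :: "(gen3, 'k :: field_char_0) ncfps" where
  "gA = nc_letter LA"

definition gB :: "nat \<Rightarrow> int \<Rightarrow> (gen3, 'k :: field_char_0) ncfps" where
  "gB N a = nc_letter (LB (a mod int N))"

definition gC :: "nat \<Rightarrow> (gen3, 'k :: field_char_0) ncfps" where
  "gC N = - gA - (\<Sum>a = 0..<int N. gB N a)"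

text \<open>\<open>sub N x X Y\<close> is \<open>x(X | Y\<^sub>i)\<close> for \<open>x\<close> in \<open>t03 N\<close> or \<open>Exp_t03 N\<close>;
  \<open>sub2 x X Y\<close> is \<open>x(X, Y)\<close> for \<open>x\<close> in \<open>t03 1\<close> or \<open>Exp_t03 1\<close>.\<close>

definition sub :: "nat \<Rightarrow> (gen3, 'k) ncfps \<Rightarrow> ('y, 'k) ncfps \<Rightarrow> (int \<Rightarrow> ('y, 'k) ncfps) \<Rightarrow>
    ('y, 'k :: field_char_0) ncfps" where
  "sub N x X Y = nc_subst (gens3 N) (case_gen3 X Y) x"

definition sub2 :: "(gen3, 'k) ncfps \<Rightarrow> ('y, 'k) ncfps \<Rightarrow> ('y, 'k) ncfps \<Rightarrow>
    ('y, 'k :: field_char_0) ncfps" where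
  "sub2 x X Y = sub 1 x X (\<lambda>_. Y)"

definition coeff_B0 :: "(gen3, 'k :: field_char_0) ncfps \<Rightarrow> 'k" where
  "coeff_B0 x = nc_coeff x [LB 0]"


section \<open>The case of \<open>t\<^sup>0\<^sub>3\<close>\<close>

definition grt1 :: "(gen3, 'k :: field_char_0) ncfps set" where
  "grt1 = {\<phi> \<in> t03 1.
     (let A = gA; B = gB 1 0; C = gC 1; t = tij 1 0 in
      sub2 \<phi> A B + sub2 \<phi> B A = 0 \<and>
      sub2 \<phi> A B + sub2 \<phi> B C + sub2 \<phi> C A = 0 \<and>
      lie B (sub2 \<phi> A B) + lie C (sub2 \<phi> A C) = 0 \<and>
      t_eq 4 1
        (sub2 \<phi> (t1 2) (t 2 3 + t 2 4) + sub2 \<phi> (t1 3 + t 2 3) (t 3 4))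
        (sub2 \<phi> (t 2 3) (t 3 4) + sub2 \<phi> (t1 2 + t1 3) (t 2 4 + t 3 4)
          + sub2 \<phi> (t1 2) (t 2 3)))}"

definition pentagon :: "(gen3, 'k :: field_char_0) ncfps \<Rightarrow> bool" where
  "pentagon g \<longleftrightarrow>
     (let t = tij 1 0 in
      Ut_eq 4 1
        (sub2 g (t1 2) (t 2 3 + t 2 4) * sub2 g (t1 3 + t 2 3) (t 3 4))
        (sub2 g (t 2 3) (t 3 4) * sub2 g (t1 2 + t1 3) (t 2 4 + t 3 4)
          * sub2 g (t1 2) (t 2 3)))"

definition GRT1 :: "(gen3, 'k :: field_char_0) ncfps set" where
  "GRT1 = {g \<in> Exp_t03 1. pentagon g \<and>
     (let A = gA; B = gB 1 0; C = gC 1 in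
      sub2 g A B * sub2 g B A = 1 \<and>
      sub2 g C A * sub2 g B C * sub2 g A B = 1 \<and>
      A + nc_inv (sub2 g A B) * B * sub2 g A B + nc_inv (sub2 g A C) * C * sub2 g A C = 0)}"

definition M1 :: "(gen3, 'k :: field_char_0) ncfps set" where
  "M1 = {g \<in> Exp_t03 1. pentagon g \<and>
     (let A = gA; B = gB 1 0; C = gC 1; e = (\<lambda>x. nc_exp ((1 / 2) \<cdot> x)) in
      sub2 g A B * sub2 g B A = 1 \<and>
      e A * sub2 g C A * e C * sub2 g B C * e B * sub2 g A B = 1)}"


section \<open>The cyclotomic case\<close>

text \<open>
  In \<open>x(X | Y\<^sub>i)\<close> the index \<open>i\<close> is bound: e.g. \<open>sub N \<psi> A (\<lambda>i. B (a + i))\<close> is the image of \<open>\<psi>\<close> under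
  \<open>B(i) \<mapsto> B(a + i)\<close>, so that the octagon and the special derivation condition are single equations.
\<close>

definition grtm :: "nat \<Rightarrow> ((gen3, 'k :: field_char_0) ncfps \<times> (gen3, 'k) ncfps) set" where
  "grtm N = {(\<phi>, \<psi>). \<phi> \<in> grt1 \<and> \<psi> \<in> t03 N \<and> coeff_B0 \<psi> = 0 \<and>
     (let t = tij N; s = tsum N in
      t_eq 4 N
        (sub N \<psi> (t1 2) (\<lambda>a. t a 2 3 + t a 2 4) + sub N \<psi> (t1 3 + s 2 3) (\<lambda>a. t a 3 4))
        (sub2 \<phi> (t 0 2 3) (t 0 3 4)
          + sub N \<psi> (t1 2 + t1 3 + s 2 3) (\<lambda>a. t a 2 4 + t a 3 4)
          + sub N \<psi> (t1 2) (\<lambda>a. t a 2 3))) \<and>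
     (let A = gA; B = gB N; C = gC N in
      sub N \<psi> A (\<lambda>i. B i) - sub N \<psi> A (\<lambda>i. B (i + 1))
        + sub N \<psi> C (\<lambda>i. B (1 - i)) - sub N \<psi> C (\<lambda>i. B (- i)) = 0 \<and>
      (\<Sum>a = 0..<int N. lie (sub N \<psi> A (\<lambda>i. B (a + i))) (B a))
        + lie (sub N \<psi> A (\<lambda>i. B i) - sub N \<psi> C (\<lambda>i. B (- i))) C = 0)}"

definition mixed_pentagon ::
  "nat \<Rightarrow> (gen3, 'k :: field_char_0) ncfps \<Rightarrow> (gen3, 'k) ncfps \<Rightarrow> bool" where
  "mixed_pentagon N g h \<longleftrightarrow>
     (let t = tij N; s = tsum N in
      Ut_eq 4 N
        (sub N h (t1 2) (\<lambda>a. t a 2 3 + t a 2 4) * sub N h (t1 3 + s 2 3) (\<lambda>a. t a 3 4))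
        (sub2 g (t 0 2 3) (t 0 3 4)
          * sub N h (t1 2 + t1 3 + s 2 3) (\<lambda>a. t a 2 4 + t a 3 4)
          * sub N h (t1 2) (\<lambda>a. t a 2 3)))"

definition GRTM :: "nat \<Rightarrow> ((gen3, 'k :: field_char_0) ncfps \<times> (gen3, 'k) ncfps) set" where
  "GRTM N = {(g, h). g \<in> GRT1 \<and> h \<in> Exp_t03 N \<and> coeff_B0 h = 0 \<and> mixed_pentagon N g h \<and>
     (let A = gA; B = gB N; C = gC N in
      nc_inv (sub N h A (\<lambda>i. B (i + 1))) * sub N h C (\<lambda>i. B (1 - i))
        * nc_inv (sub N h C (\<lambda>i. B (- i))) * sub N h A (\<lambda>i. B i) = 1 \<and>
      A + (\<Sum>a = 0..<int N. Ad (nc_inv (sub N h A (\<lambda>i. B (a + i)))) (B a))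
        + Ad (nc_inv (sub N h A (\<lambda>i. B i)) * sub N h C (\<lambda>i. B (- i))) C = 0)}"

definition Pseudo :: "nat \<Rightarrow> ((gen3, 'k :: field_char_0) ncfps \<times> (gen3, 'k) ncfps) set" where
  "Pseudo N = {(g, h). g \<in> M1 \<and> h \<in> Exp_t03 N \<and> coeff_B0 h = 0 \<and> mixed_pentagon N g h \<and>
     (let A = gA; B = gB N; C = gC N in
      nc_inv (sub N h A (\<lambda>i. B (i + 1))) * nc_exp ((1 / 2) \<cdot> B 1)
        * sub N h C (\<lambda>i. B (1 - i)) * nc_exp ((1 / of_nat N) \<cdot> C)
        * nc_inv (sub N h C (\<lambda>i. B (- i))) * nc_exp ((1 / 2) \<cdot> B 0)
        * sub N h A (\<lambda>i. B i) * nc_exp ((1 / of_nat N) \<cdot> A) = 1)}"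


section \<open>Distribution relations\<close>

definition pi_map :: "nat \<Rightarrow> nat \<Rightarrow> (gen3, 'k :: field_char_0) ncfps \<Rightarrow> (gen3, 'k) ncfps" where
  "pi_map N N' x = sub N x (of_nat (N div N') \<cdot> gA) (\<lambda>a. gB N' a)"

definition delta_map :: "nat \<Rightarrow> nat \<Rightarrow> (gen3, 'k :: field_char_0) ncfps \<Rightarrow> (gen3, 'k) ncfps" where
  "delta_map N N' x =
     (let d = int (N div N') in sub N x gA (\<lambda>a. if d dvd a then gB N' (a div d) else 0))"

definition rho :: "nat \<Rightarrow> nat \<Rightarrow> (gen3, 'k :: field_char_0) ncfps \<Rightarrow> 'k" where
  "rho N N' x = coeff_B0 (pi_map N N' x) - coeff_B0 x"

definition grtmd :: "nat \<Rightarrow> ((gen3, 'k :: field_char_0) ncfps \<times> (gen3, 'k) ncfps) set" where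
  "grtmd N = {(\<phi>, \<psi>) \<in> grtm N.
     \<forall>N'. N' dvd N \<longrightarrow> pi_map N N' \<psi> - delta_map N N' \<psi> = rho N N' \<psi> \<cdot> gB N' 0}"

definition group_distribution :: "nat \<Rightarrow> (gen3, 'k :: field_char_0) ncfps \<Rightarrow> bool" where
  "group_distribution N h \<longleftrightarrow>
     (\<forall>N'. N' dvd N \<longrightarrow> pi_map N N' h = nc_exp (rho N N' h \<cdot> gB N' 0) * delta_map N N' h)"

definition GRTMD :: "nat \<Rightarrow> ((gen3, 'k :: field_char_0) ncfps \<times> (gen3, 'k) ncfps) set" where
  "GRTMD N = {(g, h) \<in> GRTM N. group_distribution N h}"

definition Psdist :: "nat \<Rightarrow> ((gen3, 'k :: field_char_0) ncfps \<times> (gen3, 'k) ncfps) set" where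
  "Psdist N = {(g, h) \<in> Pseudo N. group_distribution N h}"

end

theory Submission
  imports Defs
begin

text \<open>
  Killing the first strand turns the mixed pentagon into an equation in \<open>t\<^sup>0\<^sub>3\<close> in which all but two
  factors have commuting arguments: for \<open>d | N\<close>, killing also all \<open>t(a)\<^sup>i\<^sup>j\<close> with \<open>d\<close> not dividing
  \<open>a\<close> gives
  \<open>h(0 | - e\<^sub>a B) h(m A | e\<^sub>a B) = g(A, B) h(m A | - e\<^sub>a A) h(0 | e\<^sub>a A)\<close>, where \<open>e\<^sub>a\<close> is the indicator of
  \<open>d | a\<close> and \<open>m = \<Sum>\<^sub>a e\<^sub>a\<close>. A grouplike series with commuting arguments is the exponential of its linear
  part, and the coefficient of \<open>A\<close> in \<open>h\<close> vanishes (set all generators but \<open>t\<^sup>1\<^sup>2\<close> to zero), so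
  \<open>h(m A | e\<^sub>a B)\<close> equals \<open>g(A, B)\<close> up to an explicit power of \<open>e\<^sup>B\<close>. For \<open>d = 1\<close> the left-hand side is
  the image of \<open>h\<close> under \<open>\<pi>\<close>, for \<open>d = N\<close> its image under \<open>\<delta>\<close>, both for \<open>N' = 1\<close>. The Lie algebra
  case is the additive analogue, and \<open>N' = N\<close> is trivial.
\<close>

section \<open>Coefficient calculus for noncommutative series\<close>

lemmas nc_coeff_simps [simp] =
  zero_ncfps.rep_eq one_ncfps.rep_eq plus_ncfps.rep_eq minus_ncfps.rep_eq uminus_ncfps.rep_eq
  nc_letter.rep_eq nc_smul.rep_eq nc_hom.rep_eq

lemma nc_coeff_sum [simp]: "nc_coeff (sum f A) w = (\<Sum>x\<in>A. nc_coeff (f x) w)"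
  by (induction A rule: infinite_finite_induct) simp_all

lemma nc_smul_simps [simp]:
  fixes f :: "('x, 'k :: ring_1) ncfps"
  shows "0 \<cdot> f = 0" "1 \<cdot> f = f" "c \<cdot> (0 :: ('x, 'k) ncfps) = 0"
  by (rule ncfps_eqI, simp)+

lemma nc_smul_mult:
  fixes f g :: "('x, 'k :: comm_ring_1) ncfps"
  shows "(a \<cdot> f) * (b \<cdot> g) = (a * b) \<cdot> (f * g)"
  by (rule ncfps_eqI) (simp add: times_ncfps.rep_eq sum_distrib_left mult_ac)

lemma lie_zero [simp]: "lie 0 x = 0" "lie x 0 = 0"
  by (simp_all add: lie_def)

text \<open>Each factor starts in degree at least 1, so a product of \<open>k\<close> factors starts
  in degree at least \<open>k\<close>. This is what makes the truncated sum in
  \<open>nc_subst\<close> equal to the full one.\<close>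

lemma nc_coeff_prod_list_eq_0:
  assumes "\<And>f. f \<in> set fs \<Longrightarrow> nc_coeff f [] = (0 :: 'k :: ring_1)" "length w < length fs"
  shows "nc_coeff (prod_list fs) w = 0"
  using assms
proof (induction fs arbitrary: w)
  case (Cons f fs)
  have "nc_coeff f (take i w) * nc_coeff (prod_list fs) (drop i w) = 0" if "i \<le> length w" for i
  proof (cases i)
    case 0
    then show ?thesis using Cons.prems by simp
  next
    case (Suc j)
    then show ?thesis using Cons.prems that by (simp add: Cons.IH)
  qed
  then show ?case by (simp add: times_ncfps.rep_eq)
qed simp


section \<open>Substitution\<close>

text \<open>The cutoff \<open>length w\<close> may be raised to any larger \<open>m\<close>, since
  longer words contribute zero. Coefficients at several words, such as the prefixes and suffixes of
  one word, can then be summed over a common finite set.\<close>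

lemma nc_subst_coeff_bound:
  fixes s :: "'x \<Rightarrow> ('y, 'k :: ring_1) ncfps"
  assumes "finite X" "\<And>x. nc_coeff (s x) [] = 0" "length w \<le> m"
  shows "nc_coeff (nc_subst X s f) w =
    (\<Sum>v | set v \<subseteq> X \<and> length v \<le> m. nc_coeff f v * nc_coeff (prod_list (map s v)) w)"
  unfolding nc_subst.rep_eq
proof (rule sum.mono_neutral_left)
  show "finite {v. set v \<subseteq> X \<and> length v \<le> m}"
    using assms by (simp add: finite_lists_length_le)
  show "{v. set v \<subseteq> X \<and> length v \<le> length w} \<subseteq> {v. set v \<subseteq> X \<and> length v \<le> m}"
    using assms by auto
  show "\<forall>v\<in>{v. set v \<subseteq> X \<and> length v \<le> m} - {v. set v \<subseteq> X \<and> length v \<le> length w}.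
      nc_coeff f v * nc_coeff (prod_list (map s v)) w = 0"
  proof
    fix v
    assume "v \<in> {v. set v \<subseteq> X \<and> length v \<le> m} - {v. set v \<subseteq> X \<and> length v \<le> length w}"
    then have "nc_coeff (prod_list (map s v)) w = 0"
      using assms(2) by (intro nc_coeff_prod_list_eq_0) auto
    then show "nc_coeff f v * nc_coeff (prod_list (map s v)) w = 0" by simp
  qed
qed

lemma nc_subst_add: "nc_subst X s (f + g) = nc_subst X s f + nc_subst X s g"
  by (rule ncfps_eqI) (simp add: nc_subst.rep_eq distrib_right sum.distrib)

lemma nc_subst_diff: "nc_subst X s (f - g) = nc_subst X s f - nc_subst X s g"
  by (rule ncfps_eqI) (simp add: nc_subst.rep_eq left_diff_distrib sum_subtractf)

lemma nc_subst_zero [simp]: "nc_subst X s 0 = 0"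
  by (rule ncfps_eqI) (simp add: nc_subst.rep_eq)

lemma nc_subst_smul: "nc_subst X s (c \<cdot> f) = c \<cdot> nc_subst X s f"
  by (rule ncfps_eqI) (simp add: nc_subst.rep_eq sum_distrib_left mult.assoc)

lemma nc_subst_sum: "nc_subst X s (sum f A) = (\<Sum>a\<in>A. nc_subst X s (f a))"
  by (induction A rule: infinite_finite_induct) (simp_all add: nc_subst_add)

lemma nc_subst_cong:
  assumes "\<And>x. x \<in> X \<Longrightarrow> s x = s' x"
  shows "nc_subst X s f = nc_subst X s' f"
proof -
  have eq: "map s v = map s' v" if "set v \<subseteq> X" for v
    using that assms by auto
  show ?thesis
    unfolding nc_coeff_inject[symmetric] nc_subst.rep_eq
    by (intro ext sum.cong refl) (simp add: eq)
qed

lemma nc_coeff_subst_Nil [simp]: "nc_coeff (nc_subst X s f) [] = nc_coeff f []"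
proof -
  have "{v. set v \<subseteq> X \<and> v = []} = {[]}" by auto
  then show ?thesis by (simp add: nc_subst.rep_eq)
qed

lemma sum_words_le_Suc_0:
  assumes "finite X"
  shows "(\<Sum>v | set v \<subseteq> X \<and> length v \<le> Suc 0. F v) = F [] + (\<Sum>x\<in>X. F [x])"
proof -
  have "{v. set v \<subseteq> X \<and> length v \<le> Suc 0} = insert [] ((\<lambda>x. [x]) ` X)"
    by (auto simp: le_Suc_eq length_Suc_conv)
  then have "(\<Sum>v | set v \<subseteq> X \<and> length v \<le> Suc 0. F v) = F [] + sum F ((\<lambda>x. [x]) ` X)"
    using assms by (simp add: image_iff)
  also have "sum F ((\<lambda>x. [x]) ` X) = (\<Sum>x\<in>X. F [x])"
    by (subst sum.reindex) (simp_all add: inj_on_def)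
  finally show ?thesis .
qed

lemma nc_coeff_subst_letter:
  assumes "finite X"
  shows "nc_coeff (nc_subst X s f) [y] = (\<Sum>x\<in>X. nc_coeff f [x] * nc_coeff (s x) [y])"
  using assms by (simp add: nc_subst.rep_eq sum_words_le_Suc_0)

lemma nc_subst_one [simp]:
  assumes "finite X"
  shows "nc_subst X s 1 = 1"
proof (rule ncfps_eqI)
  fix w :: "'b list"
  have "nc_coeff (nc_subst X s 1) w =
      (\<Sum>v\<in>{v. set v \<subseteq> X \<and> length v \<le> length w}. if v = [] then nc_coeff 1 w else 0)"
    unfolding nc_subst.rep_eq by (rule sum.cong) auto
  then show "nc_coeff (nc_subst X s 1) w = nc_coeff 1 w"
    using assms by (simp add: finite_lists_length_le)
qed

lemma nc_subst_letter:
  fixes s :: "'x \<Rightarrow> ('y, 'k :: ring_1) ncfps"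
  assumes "finite X" "x \<in> X" "nc_coeff (s x) [] = 0"
  shows "nc_subst X s (nc_letter x) = s x"
proof (rule ncfps_eqI)
  fix w :: "'y list"
  have "nc_coeff (nc_subst X s (nc_letter x)) w =
      (\<Sum>v\<in>{v. set v \<subseteq> X \<and> length v \<le> length w}. if v = [x] then nc_coeff (s x) w else 0)"
    unfolding nc_subst.rep_eq by (rule sum.cong) auto
  then show "nc_coeff (nc_subst X s (nc_letter x)) w = nc_coeff (s x) w"
    using assms by (cases w) (simp_all add: finite_lists_length_le)
qed

lemma nc_subst_mult:
  fixes s :: "'x \<Rightarrow> ('y, 'k :: comm_ring_1) ncfps"
  assumes X: "finite X" and s: "\<And>x. nc_coeff (s x) [] = 0"
  shows "nc_subst X s (f * g) = nc_subst X s f * nc_subst X s g"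
proof (rule ncfps_eqI)
  fix w :: "'y list"
  define W where "W = {v. set v \<subseteq> X \<and> length v \<le> length w}"
  define P where "P v = prod_list (map s v)" for v
  have fin: "finite W" unfolding W_def using X by (rule finite_lists_length_le)
  have "nc_coeff (nc_subst X s f * nc_subst X s g) w =
      (\<Sum>j\<le>length w. \<Sum>u\<in>W. \<Sum>v\<in>W. nc_coeff f u * nc_coeff g v *
        (nc_coeff (P u) (take j w) * nc_coeff (P v) (drop j w)))"
    unfolding times_ncfps.rep_eq
    by (intro sum.cong refl)
       (simp add: nc_subst_coeff_bound[OF X s, where m = "length w"] W_def[symmetric] P_def
         sum_product mult_ac)
  also have "\<dots> = (\<Sum>u\<in>W. \<Sum>v\<in>W. \<Sum>j\<le>length w. nc_coeff f u * nc_coeff g v *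
        (nc_coeff (P u) (take j w) * nc_coeff (P v) (drop j w)))"
    by (subst sum.swap, intro sum.cong refl, rule sum.swap)
  also have "\<dots> = (\<Sum>u\<in>W. \<Sum>v\<in>W. nc_coeff f u * nc_coeff g v * nc_coeff (P (u @ v)) w)"
    by (simp add: P_def times_ncfps.rep_eq sum_distrib_left)
  also have "\<dots> = (\<Sum>(u, v)\<in>W \<times> W. nc_coeff f u * nc_coeff g v * nc_coeff (P (u @ v)) w)"
    by (rule sum.cartesian_product)
  \<comment> \<open>Pairs whose concatenation exceeds the cutoff contribute zero: their product has
    too many factors without constant term.\<close>
  also have "\<dots> = (\<Sum>(u, v) | (u, v) \<in> W \<times> W \<and> u @ v \<in> W.
      nc_coeff f u * nc_coeff g v * nc_coeff (P (u @ v)) w)"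
  proof (rule sum.mono_neutral_right)
    have "nc_coeff (P (u @ v)) w = 0" if "u \<in> W" "v \<in> W" "u @ v \<notin> W" for u v
      unfolding P_def using that s by (intro nc_coeff_prod_list_eq_0) (auto simp: W_def)
    then show "\<forall>q\<in>W \<times> W - {(u, v). (u, v) \<in> W \<times> W \<and> u @ v \<in> W}.
        (case q of (u, v) \<Rightarrow> nc_coeff f u * nc_coeff g v * nc_coeff (P (u @ v)) w) = 0"
      by (auto, metis mult_zero_right)
  qed (use fin in auto)
  \<comment> \<open>A pair \<open>(u, v)\<close> is the same as the word \<open>u @ v\<close>
    together with the cutting position \<open>length u\<close>.\<close>
  also have "\<dots> = (\<Sum>(v, i)\<in>(SIGMA v:W. {..length v}).
      nc_coeff f (take i v) * nc_coeff g (drop i v) * nc_coeff (P v) w)"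
    by (rule sum.reindex_bij_witness[where i = "\<lambda>(v, i). (take i v, drop i v)"
          and j = "\<lambda>(u, v). (u @ v, length u)"])
       (auto simp: W_def dest: in_set_takeD in_set_dropD)
  also have "\<dots> = nc_coeff (nc_subst X s (f * g)) w"
    using fin unfolding nc_subst.rep_eq times_ncfps.rep_eq W_def[symmetric] P_def[symmetric]
    by (subst sum.Sigma[symmetric]) (auto simp: sum_distrib_right)
  finally show "nc_coeff (nc_subst X s (f * g)) w = nc_coeff (nc_subst X s f * nc_subst X s g) w" ..
qed

lemma nc_subst_lie:
  fixes s :: "'x \<Rightarrow> ('y, 'k :: comm_ring_1) ncfps"
  assumes "finite X" "\<And>x. nc_coeff (s x) [] = 0"
  shows "nc_subst X s (lie f g) = lie (nc_subst X s f) (nc_subst X s g)"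
  using assms by (simp add: lie_def nc_subst_diff nc_subst_mult)

lemma nc_subst_prod_list:
  fixes s :: "'x \<Rightarrow> ('y, 'k :: comm_ring_1) ncfps"
  assumes "finite X" "\<And>x. nc_coeff (s x) [] = 0"
  shows "nc_subst X s (prod_list fs) = prod_list (map (nc_subst X s) fs)"
  using assms by (induction fs) (simp_all add: nc_subst_mult)

text \<open>With a common cutoff the two finite sums can be swapped; the outer substitution then
  acts factorwise on each product of values of \<open>s\<close>.\<close>

lemma nc_subst_subst:
  fixes s :: "'x \<Rightarrow> ('y, 'k :: comm_ring_1) ncfps" and t :: "'y \<Rightarrow> ('z, 'k) ncfps"
  assumes X: "finite X" and s: "\<And>x. nc_coeff (s x) [] = 0"
    and Y: "finite Y" and t: "\<And>y. nc_coeff (t y) [] = 0"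
  shows "nc_subst Y t (nc_subst X s f) = nc_subst X (\<lambda>x. nc_subst Y t (s x)) f"
proof (rule ncfps_eqI)
  fix w :: "'z list"
  define V where "V = {v. set v \<subseteq> X \<and> length v \<le> length w}"
  define U where "U = {u. set u \<subseteq> Y \<and> length u \<le> length w}"
  have "nc_coeff (nc_subst Y t (nc_subst X s f)) w =
      (\<Sum>u\<in>U. \<Sum>v\<in>V. nc_coeff f v * (nc_coeff (prod_list (map s v)) u *
        nc_coeff (prod_list (map t u)) w))"
    unfolding nc_subst.rep_eq[of Y] U_def[symmetric]
    by (intro sum.cong refl)
       (simp add: nc_subst_coeff_bound[OF X s, where m = "length w"] U_def V_def[symmetric]
         sum_distrib_right mult.assoc)
  also have "\<dots> = (\<Sum>v\<in>V. nc_coeff f v * nc_coeff (nc_subst Y t (prod_list (map s v))) w)"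
    by (subst sum.swap) (simp add: nc_subst.rep_eq U_def[symmetric] sum_distrib_left)
  also have "\<dots> = nc_coeff (nc_subst X (\<lambda>x. nc_subst Y t (s x)) f) w"
    by (simp add: nc_subst_prod_list[OF Y t] nc_subst.rep_eq[of X] V_def o_def)
  finally show "nc_coeff (nc_subst Y t (nc_subst X s f)) w =
    nc_coeff (nc_subst X (\<lambda>x. nc_subst Y t (s x)) f) w" .
qed

text \<open>Only components of degree at most \<open>length w\<close> are visible at
  \<open>w\<close>. This reduces statements about completions to homogeneous elements, which lie in
  the uncompleted space.\<close>

lemma nc_subst_coeff_hom:
  fixes s :: "'x \<Rightarrow> ('y, 'k :: ring_1) ncfps"
  shows "nc_coeff (nc_subst X s f) w = (\<Sum>m\<le>length w. nc_coeff (nc_subst X s (nc_hom m f)) w)"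
proof -
  have "nc_coeff (nc_subst X s f) w = (\<Sum>v | set v \<subseteq> X \<and> length v \<le> length w.
      \<Sum>m\<le>length w. nc_coeff (nc_hom m f) v * nc_coeff (prod_list (map s v)) w)"
    unfolding nc_subst.rep_eq[of X s f]
    by (rule sum.cong) (simp_all add: if_distrib[of "\<lambda>c. c * _"] cong: if_cong)
  also have "\<dots> = (\<Sum>m\<le>length w. nc_coeff (nc_subst X s (nc_hom m f)) w)"
    by (subst sum.swap) (simp add: nc_subst.rep_eq)
  finally show ?thesis .
qed

lemma nc_subst_completion_eq_0:
  assumes "f \<in> completion V" "\<And>g. g \<in> V \<Longrightarrow> nc_subst X s g = 0"
  shows "nc_subst X s f = 0"
  using assms by (intro ncfps_eqI) (simp add: nc_subst_coeff_hom[of X s f] completion_def)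


section \<open>Substitutions with commuting values\<close>

text \<open>All values are multiples of one series \<open>y\<close>, so every bracket is sent to 0
  and only the linear part survives.\<close>

lemma nc_subst_free_lie_commuting:
  fixes y :: "('y, 'k :: field_char_0) ncfps"
  assumes X: "finite X" and y: "nc_coeff y [] = 0" and f: "f \<in> free_lie X"
  shows "nc_subst X (\<lambda>x. c x \<cdot> y) f = (\<Sum>x\<in>X. nc_coeff f [x] * c x) \<cdot> y"
  using f
proof induction
  case (letter x)
  have "(\<Sum>z\<in>X. nc_coeff (nc_letter x :: ('a, 'k) ncfps) [z] * c z) = (\<Sum>z\<in>X. if z = x then c z else 0)"
    by (rule sum.cong) auto
  then show ?case using X y letter by (simp add: nc_subst_letter)
next
  case zero
  then show ?case by simp
next
  case (add f g)
  then show ?case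
    by (intro ncfps_eqI) (simp add: nc_subst_add distrib_right sum.distrib)
next
  case (smul f a)
  then show ?case
    by (intro ncfps_eqI) (simp add: nc_subst_smul mult.assoc sum_distrib_left[symmetric])
next
  case (lie f g)
  \<comment> \<open>Lie polynomials have no constant term, so a bracket of two of them has no linear
    term and the right-hand side vanishes as well.\<close>
  have nil: "nc_coeff h [] = 0" if "h \<in> free_lie X" for h :: "('a, 'k) ncfps"
    using that by induction (simp_all add: lie_def times_ncfps.rep_eq)
  have "nc_coeff (lie f g) [x] = 0" for x
    using nil lie.hyps by (simp add: lie_def times_ncfps.rep_eq)
  moreover have "nc_subst X (\<lambda>x. c x \<cdot> y) (lie f g) = 0"
    using X y lie.IH by (simp add: nc_subst_lie) (simp add: lie_def nc_smul_mult mult.commute)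
  ultimately show ?case by simp
qed

lemma nc_subst_lie_commuting:
  fixes y :: "('y, 'k :: field_char_0) ncfps"
  assumes X: "finite X" and y: "nc_coeff y [] = 0" and f: "f \<in> completion (free_lie X)"
  shows "nc_subst X (\<lambda>x. c x \<cdot> y) f = (\<Sum>x\<in>X. nc_coeff f [x] * c x) \<cdot> y"
proof (rule ncfps_eqI)
  fix w :: "'y list"
  have "nc_subst X (\<lambda>x. c x \<cdot> y) (nc_hom m f) =
      (\<Sum>x\<in>X. nc_coeff (nc_hom m f) [x] * c x) \<cdot> y" for m
    using f by (intro nc_subst_free_lie_commuting X y) (auto simp: completion_def)
  then have "nc_subst X (\<lambda>x. c x \<cdot> y) (nc_hom m f) =
      (if m = 1 then (\<Sum>x\<in>X. nc_coeff f [x] * c x) \<cdot> y else 0)" for m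
    by simp
  then have "nc_coeff (nc_subst X (\<lambda>x. c x \<cdot> y) f) w =
      (\<Sum>m\<le>length w. if m = 1 then nc_coeff ((\<Sum>x\<in>X. nc_coeff f [x] * c x) \<cdot> y) w else 0)"
    unfolding nc_subst_coeff_hom[of X _ f] by (intro sum.cong refl) simp
  then show "nc_coeff (nc_subst X (\<lambda>x. c x \<cdot> y) f) w =
      nc_coeff ((\<Sum>x\<in>X. nc_coeff f [x] * c x) \<cdot> y) w"
    \<comment> \<open>At the empty word the range of \<open>m\<close> does not reach 1; there the
      right-hand side is 0 because \<open>y\<close> has no constant term.\<close>
    using y by (cases "w = []") (simp_all add: Suc_le_eq)
qed

section \<open>Exponentials as power series in one variable\<close>

lemma nc_coeff_exp: "nc_coeff (nc_exp f) w = (\<Sum>n\<le>length w. nc_coeff (f ^ n) w / fact n)"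
  by (simp add: nc_exp_def Abs_ncfps_inverse)

lemma nc_exp_zero [simp]: "nc_exp 0 = 1"
proof (rule ncfps_eqI)
  fix w :: "'a list"
  have "nc_coeff (nc_exp 0 :: ('a, 'b) ncfps) w = (\<Sum>n\<le>length w. if n = 0 then nc_coeff 1 w else 0)"
    unfolding nc_coeff_exp by (rule sum.cong) (auto simp: power_0_left)
  then show "nc_coeff (nc_exp 0 :: ('a, 'b) ncfps) w = nc_coeff 1 w" by simp
qed

text \<open>Words over a one-letter alphabet are determined by their length, so series over
  \<open>unit\<close> serve as ordinary power series.\<close>

lemma sum_words_unit:
  "(\<Sum>v | set v \<subseteq> (UNIV :: unit set) \<and> length v \<le> m. F v) = (\<Sum>n\<le>m. F (replicate n ()))"
proof (rule sum.reindex_bij_witness)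
  fix v :: "unit list"
  assume v: "v \<in> {v. set v \<subseteq> UNIV \<and> length v \<le> m}"
  show eq: "replicate (length v) () = v" by (rule replicate_length_same) simp
  show "length v \<in> {..m}" using v by simp
  show "F (replicate (length v) ()) = F v" by (simp only: eq)
next
  fix n assume "n \<in> {..m}"
  then show "replicate n () \<in> {v. set v \<subseteq> UNIV \<and> length v \<le> m}" by simp
  show "length (replicate n ()) = n" by simp
qed

lemma prod_list_smul_const:
  fixes y :: "('y, 'k :: comm_ring_1) ncfps"
  shows "prod_list (map (\<lambda>x. c x \<cdot> y) v) = prod_list (map c v) \<cdot> y ^ length v"
  by (induction v) (simp_all add: nc_smul_mult)

text \<open>Substitution transports the functional equation of \<open>exp\<close> from this series in one letter.\<close>

definition exp_series :: "'k :: field_char_0 \<Rightarrow> (unit, 'k) ncfps" where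
  "exp_series c = Abs_ncfps (\<lambda>w. c ^ length w / fact (length w))"

lemma nc_coeff_exp_series: "nc_coeff (exp_series c) w = c ^ length w / fact (length w)"
  by (simp add: exp_series_def Abs_ncfps_inverse)

lemma exp_series_mult: "exp_series a * exp_series b = exp_series (a + b)"
proof (rule ncfps_eqI)
  fix w :: "unit list"
  let ?n = "length w"
  have "(a + b) ^ ?n / fact ?n = (\<Sum>i\<le>?n. of_nat (?n choose i) / fact ?n * (a ^ i * b ^ (?n - i)))"
    by (simp add: binomial_ring sum_divide_distrib mult.assoc)
  also have "\<dots> = (\<Sum>i\<le>?n. a ^ i / fact i * (b ^ (?n - i) / fact (?n - i)))"
    by (rule sum.cong) (simp_all add: binomial_fact)
  finally show "nc_coeff (exp_series a * exp_series b) w = nc_coeff (exp_series (a + b)) w"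
    by (simp add: times_ncfps.rep_eq nc_coeff_exp_series)
qed

lemma nc_coeff_subst_unit:
  "nc_coeff (nc_subst UNIV (\<lambda>_. y) f) w =
    (\<Sum>n\<le>length w. nc_coeff f (replicate n ()) * nc_coeff (y ^ n) w)"
  unfolding nc_subst.rep_eq sum_words_unit by (simp add: map_replicate)

lemma nc_smul_power:
  fixes y :: "('y, 'k :: comm_ring_1) ncfps"
  shows "(c \<cdot> y) ^ n = c ^ n \<cdot> y ^ n"
  by (induction n) (simp_all add: nc_smul_mult)

text \<open>Both sides are truncated at \<open>n \<le> length w\<close> and agree term by
  term.\<close>

lemma nc_exp_smul: "nc_exp (c \<cdot> y) = nc_subst UNIV (\<lambda>_. y) (exp_series c)"
  by (rule ncfps_eqI)
     (simp add: nc_coeff_exp nc_coeff_subst_unit nc_coeff_exp_series nc_smul_power)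

lemma nc_exp_smul_add:
  assumes "nc_coeff y [] = 0"
  shows "nc_exp (a \<cdot> y) * nc_exp (b \<cdot> y) = nc_exp ((a + b) \<cdot> y)"
  using assms by (simp add: nc_exp_smul nc_subst_mult[symmetric] exp_series_mult)

section \<open>Splitting words and evaluating grouplike series in commuting arguments\<close>

lemma in_shuffles_nths: "w \<in> shuffles (nths w S) (nths w (- S))"
proof (induction w arbitrary: S)
  case (Cons x w)
  have "{j. Suc j \<in> - S} = - {j. Suc j \<in> S}" by auto
  then show ?case
    using Cons.IH[of "{j. Suc j \<in> S}"]
    by (simp add: nths_Cons Cons_in_shuffles_leftI Cons_in_shuffles_rightI)
qed simp

text \<open>Complementation turns these sets into the one-element subsets. The complement is spelled
  out in the form in which \<open>length_nths\<close> yields it.\<close>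

lemma card_subsets_complement_singleton:
  "card {S. S \<subseteq> {..<Suc n} \<and> card {i. i < Suc n \<and> i \<notin> S} = 1} = Suc n"
proof -
  have "card {S. S \<subseteq> {..<Suc n} \<and> card {i. i < Suc n \<and> i \<notin> S} = 1} =
      card {S. S \<subseteq> {..<Suc n} \<and> card S = 1}"
  proof (rule bij_betw_same_card[where f = "\<lambda>S. {..<Suc n} - S"],
      rule bij_betw_byWitness[where f' = "\<lambda>S. {..<Suc n} - S"])
    have *: "{i. i < Suc n \<and> i \<notin> S} = {..<Suc n} - S" for S by auto
    show "(\<lambda>S. {..<Suc n} - S) ` {S. S \<subseteq> {..<Suc n} \<and> card {i. i < Suc n \<and> i \<notin> S} = 1}
        \<subseteq> {S. S \<subseteq> {..<Suc n} \<and> card S = 1}"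
      unfolding * by auto
    show "(\<lambda>S. {..<Suc n} - S) ` {S. S \<subseteq> {..<Suc n} \<and> card S = 1}
        \<subseteq> {S. S \<subseteq> {..<Suc n} \<and> card {i. i < Suc n \<and> i \<notin> S} = 1}"
      unfolding * by (auto simp: double_diff)
  qed auto
  also have "\<dots> = Suc n" by (simp add: n_subsets)
  finally show ?thesis .
qed

text \<open>A set \<open>S\<close> of positions determines the pair \<open>(u, x)\<close> it splits
  \<open>w\<close> into, so the sum counts each \<open>S\<close> with one-element complement exactly
  once.\<close>

lemma sum_card_shuffle_letter:
  assumes X: "finite X" and w: "set w \<subseteq> X" "length w = Suc n"
  shows "(\<Sum>(u, x)\<in>{u. set u \<subseteq> X \<and> length u = n} \<times> X.
      card {S. S \<subseteq> {..<length w} \<and> nths w S = u \<and> nths w (- S) = [x]}) = Suc n"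
proof -
  define U where "U = {u. set u \<subseteq> X \<and> length u = n} \<times> X"
  define M where "M q = {S. S \<subseteq> {..<length w} \<and> nths w S = fst q \<and> nths w (- S) = [snd q]}" for q
  have "finite U" unfolding U_def using X by (simp add: finite_lists_length_eq)
  moreover have "finite (M q)" for q
    by (rule finite_subset[of _ "Pow {..<length w}"]) (auto simp: M_def)
  moreover have "M q \<inter> M r = {}" if "q \<noteq> r" for q r
    using that by (auto simp: M_def prod_eq_iff)
  ultimately have "(\<Sum>q\<in>U. card (M q)) = card (\<Union> (M ` U))"
    by (simp add: card_UN_disjoint)
  also have "\<Union> (M ` U) = {S. S \<subseteq> {..<Suc n} \<and> card {i. i < Suc n \<and> i \<notin> S} = 1}"
  proof (intro set_eqI iffI)
    fix S assume "S \<in> \<Union> (M ` U)"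
    then obtain x where "S \<subseteq> {..<Suc n}" "nths w (- S) = [x]" using w by (auto simp: M_def)
    then show "S \<in> {S. S \<subseteq> {..<Suc n} \<and> card {i. i < Suc n \<and> i \<notin> S} = 1}"
      using length_nths[of w "- S"] w by simp
  next
    fix S assume S: "S \<in> {S. S \<subseteq> {..<Suc n} \<and> card {i. i < Suc n \<and> i \<notin> S} = 1}"
    then have "length (nths w (- S)) = 1" using w by (simp add: length_nths)
    then obtain x where x: "nths w (- S) = [x]" by (auto simp: length_Suc_conv)
    have "length (nths w S) = n"
      using length_shuffles[OF in_shuffles_nths[of w S]] x w by simp
    moreover have "set (nths w S) \<subseteq> X" "x \<in> X"
      using w set_nths_subset[of w S] set_nths_subset[of w "- S"] x by auto
    ultimately have "S \<in> M (nths w S, x)" "(nths w S, x) \<in> U"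
      using S w x by (auto simp: M_def U_def)
    then show "S \<in> \<Union> (M ` U)" by blast
  qed
  finally show ?thesis
    unfolding card_subsets_complement_singleton by (simp add: M_def U_def split_beta)
qed

text \<open>
  Multiplicativity of \<open>g\<close> at the pairs \<open>(u, [x])\<close>: a word of length \<open>n + 1\<close> has \<open>n + 1\<close> positions
  for the split-off letter.
\<close>

lemma grouplike_sum_words:
  fixes g :: "('x, 'k :: field_char_0) ncfps"
  assumes X: "finite X" and g: "g \<in> grouplike X"
  shows "(\<Sum>v | set v \<subseteq> X \<and> length v = n. nc_coeff g v * prod_list (map c v)) =
    (\<Sum>x\<in>X. nc_coeff g [x] * c x) ^ n / fact n"
proof (induction n)
  case 0
  have "{v. set v \<subseteq> X \<and> v = []} = {[]}" by auto
  then show ?case using g by (simp add: grouplike_def)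
next
  case (Suc n)
  define W where "W m = {v. set v \<subseteq> X \<and> length v = m}" for m
  define L where "L = (\<Sum>x\<in>X. nc_coeff g [x] * c x)"
  define N where "N u x w = card {S. S \<subseteq> {..<length w} \<and> nths w S = u \<and> nths w (- S) = [x]}"
    for u x and w :: "'x list"
  have fin: "finite (W m)" for m
    unfolding W_def using X by (rule finite_lists_length_eq)
  \<comment> \<open>The coproduct sum over shuffles extends to all words of length
    \<open>n + 1\<close>: by \<open>in_shuffles_nths\<close>, a word that is not a shuffle of
    \<open>u\<close> and \<open>[x]\<close> has multiplicity 0.\<close>
  have coprod: "nc_coeff g u * nc_coeff g [x] = (\<Sum>w\<in>W (Suc n). of_nat (N u x w) * nc_coeff g w)"
    if "u \<in> W n" "x \<in> X" for u x
  proof -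
    have sub: "shuffles u [x] \<subseteq> W (Suc n)"
      using that set_shuffles[of _ u "[x]"] length_shuffles[of _ u "[x]"] by (auto simp: W_def)
    have "N u x w = 0" if "w \<notin> shuffles u [x]" for w
      using that in_shuffles_nths[of w] by (auto simp: N_def) metis
    then have "(\<Sum>w\<in>shuffles u [x]. of_nat (N u x w) * nc_coeff g w) =
        (\<Sum>w\<in>W (Suc n). of_nat (N u x w) * nc_coeff g w)"
      using sub fin by (intro sum.mono_neutral_left) auto
    then show ?thesis
      using g by (simp add: grouplike_def nc_coprod_def N_def)
  qed
  \<comment> \<open>The product of the \<open>c\<close> values depends only on the multiset of
    letters, which a splitting preserves.\<close>
  have weight: "of_nat (N u x w) * (prod_list (map c u) * c x) =
      of_nat (N u x w) * prod_list (map c w)" for u x w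
  proof (cases "N u x w = 0")
    case False
    then have "{S. S \<subseteq> {..<length w} \<and> nths w S = u \<and> nths w (- S) = [x]} \<noteq> {}"
      unfolding N_def by (metis card.empty)
    then obtain S where "nths w S = u" "nths w (- S) = [x]" by blast
    then have "mset w = mset (u @ [x])"
      using mset_shuffles[OF in_shuffles_nths[of w S]] by simp
    then have "prod_mset (mset (map c w)) = prod_mset (mset (map c (u @ [x])))"
      by (simp only: mset_map)
    then have "prod_list (map c w) = prod_list (map c u) * c x"
      unfolding prod_mset_prod_list by simp
    then show ?thesis by simp
  qed simp
  have count: "(\<Sum>u\<in>W n. \<Sum>x\<in>X. N u x w) = Suc n" if "w \<in> W (Suc n)" for w
    using that sum_card_shuffle_letter[OF X, of w n]
    unfolding W_def N_def sum.cartesian_product by simp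
  have "(\<Sum>v\<in>W n. nc_coeff g v * prod_list (map c v)) * L =
      (\<Sum>u\<in>W n. \<Sum>x\<in>X. (nc_coeff g u * nc_coeff g [x]) * (prod_list (map c u) * c x))"
    unfolding L_def sum_product by (intro sum.cong refl) (simp add: mult_ac)
  also have "\<dots> = (\<Sum>u\<in>W n. \<Sum>x\<in>X. \<Sum>w\<in>W (Suc n).
      of_nat (N u x w) * (nc_coeff g w * prod_list (map c w)))"
  proof (intro sum.cong refl)
    fix u x assume "u \<in> W n" "x \<in> X"
    have "of_nat (N u x w) * nc_coeff g w * (prod_list (map c u) * c x) =
        of_nat (N u x w) * (nc_coeff g w * prod_list (map c w))" for w
      using weight[of u x w] by (simp add: mult_ac)
    then show "(nc_coeff g u * nc_coeff g [x]) * (prod_list (map c u) * c x) =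
        (\<Sum>w\<in>W (Suc n). of_nat (N u x w) * (nc_coeff g w * prod_list (map c w)))"
      unfolding coprod[OF \<open>u \<in> W n\<close> \<open>x \<in> X\<close>] sum_distrib_right by (rule sum.cong[OF refl])
  qed
  also have "\<dots> = (\<Sum>u\<in>W n. \<Sum>w\<in>W (Suc n). \<Sum>x\<in>X.
      of_nat (N u x w) * (nc_coeff g w * prod_list (map c w)))"
    by (intro sum.cong refl) (rule sum.swap)
  also have "\<dots> = (\<Sum>w\<in>W (Suc n). \<Sum>u\<in>W n. \<Sum>x\<in>X.
      of_nat (N u x w) * (nc_coeff g w * prod_list (map c w)))"
    by (rule sum.swap)
  also have "\<dots> = (\<Sum>w\<in>W (Suc n). of_nat (\<Sum>u\<in>W n. \<Sum>x\<in>X. N u x w) *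
      (nc_coeff g w * prod_list (map c w)))"
    unfolding of_nat_sum sum_distrib_right ..
  also have "\<dots> = of_nat (Suc n) * (\<Sum>w\<in>W (Suc n). nc_coeff g w * prod_list (map c w))"
    unfolding sum_distrib_left by (intro sum.cong refl) (simp only: count)
  finally have eq: "(\<Sum>v\<in>W n. nc_coeff g v * prod_list (map c v)) * L =
      of_nat (Suc n) * (\<Sum>w\<in>W (Suc n). nc_coeff g w * prod_list (map c w))" .
  \<comment> \<open>Writing \<open>a n\<close> for the sum over words of length \<open>n\<close>,
    this is the recursion \<open>a (n + 1) = a n * L / (n + 1)\<close>.\<close>
  have "(\<Sum>w\<in>W (Suc n). nc_coeff g w * prod_list (map c w)) =
      (\<Sum>v\<in>W n. nc_coeff g v * prod_list (map c v)) * L / of_nat (Suc n)"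
    unfolding eq by (rule nonzero_mult_div_cancel_left[symmetric]) (rule of_nat_neq_0)
  also have "\<dots> = L ^ Suc n / fact (Suc n)"
    using Suc.IH by (simp add: W_def L_def mult_ac)
  finally show ?case by (simp only: W_def L_def)
qed

text \<open>Grouping words by length, length \<open>n\<close> contributes
  \<open>L ^ n / fact n\<close> times \<open>y ^ n\<close>, by
  \<open>grouplike_sum_words\<close>.\<close>

lemma nc_subst_grouplike_commuting:
  fixes y :: "('y, 'k :: field_char_0) ncfps"
  assumes X: "finite X" and g: "g \<in> grouplike X"
  shows "nc_subst X (\<lambda>x. c x \<cdot> y) g = nc_exp ((\<Sum>x\<in>X. nc_coeff g [x] * c x) \<cdot> y)"
proof (rule ncfps_eqI)
  fix w :: "'y list"
  define L where "L = (\<Sum>x\<in>X. nc_coeff g [x] * c x)"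
  have "{v. set v \<subseteq> X \<and> length v \<le> length w} =
      (\<Union>n\<le>length w. {v. set v \<subseteq> X \<and> length v = n})"
    by auto
  then have "nc_coeff (nc_subst X (\<lambda>x. c x \<cdot> y) g) w =
      (\<Sum>n\<le>length w. \<Sum>v | set v \<subseteq> X \<and> length v = n.
        nc_coeff g v * prod_list (map c v) * nc_coeff (y ^ length v) w)"
    using X unfolding nc_subst.rep_eq prod_list_smul_const
    by (simp only: nc_smul.rep_eq mult.assoc)
       (subst sum.UNION_disjoint; force simp: finite_lists_length_eq)
  also have "\<dots> = (\<Sum>n\<le>length w. \<Sum>v | set v \<subseteq> X \<and> length v = n.
        nc_coeff g v * prod_list (map c v) * nc_coeff (y ^ n) w)"
    by (intro sum.cong refl) simp
  also have "\<dots> = (\<Sum>n\<le>length w. L ^ n / fact n * nc_coeff (y ^ n) w)"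
    by (simp add: sum_distrib_right[symmetric] grouplike_sum_words[OF X g] L_def)
  also have "\<dots> = nc_coeff (nc_exp (L \<cdot> y)) w"
    by (simp add: nc_exp_smul nc_coeff_subst_unit nc_coeff_exp_series)
  finally show "nc_coeff (nc_subst X (\<lambda>x. c x \<cdot> y) g) w =
      nc_coeff (nc_exp ((\<Sum>x\<in>X. nc_coeff g [x] * c x) \<cdot> y)) w"
    by (simp only: L_def)
qed


section \<open>Morphisms out of the quotients\<close>

lemma finite_tgens [simp]: "finite (tgens n N)"
proof (rule finite_subset)
  show "tgens n N \<subseteq> T1 ` {2..n} \<union> (\<lambda>(a, i, j). T a i j) ` ({0..<int N} \<times> {2..n} \<times> {2..n})"
    by (auto simp: tgens_def image_iff)
qed simp

lemma finite_gens3 [simp]: "finite (gens3 N)"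
  by (simp add: gens3_def)

context
  fixes n N :: nat and s :: "tgen \<Rightarrow> ('y, 'k :: field_char_0) ncfps"
  assumes s: "\<And>x. nc_coeff (s x) [] = 0"
    and rels: "\<And>r. r \<in> trels n N \<Longrightarrow> nc_subst (tgens n N) s r = 0"
begin

text \<open>A substitution that kills the defining relations kills the Lie ideal they generate and,
  degree by degree, its completion; it therefore descends to the quotient.\<close>

lemma nc_subst_t_eq:
  assumes "t_eq n N f g"
  shows "nc_subst (tgens n N) s f = nc_subst (tgens n N) s g"
proof -
  have "nc_subst (tgens n N) s r = 0" if "r \<in> lie_ideal (tgens n N) (trels n N)" for r
    using that by induction (simp_all add: rels s nc_subst_add nc_subst_smul nc_subst_lie)
  then have "nc_subst (tgens n N) s (f - g) = 0"
    by (rule nc_subst_completion_eq_0[OF assms[unfolded t_eq_def]])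
  then show ?thesis by (simp add: nc_subst_diff)
qed

lemma nc_subst_Ut_eq:
  assumes "Ut_eq n N f g"
  shows "nc_subst (tgens n N) s f = nc_subst (tgens n N) s g"
proof -
  have "nc_subst (tgens n N) s r = 0" if "r \<in> assoc_ideal (tgens n N) (trels n N)" for r
    using that by induction (simp_all add: rels s nc_subst_add nc_subst_mult)
  then have "nc_subst (tgens n N) s (f - g) = 0"
    by (rule nc_subst_completion_eq_0[OF assms[unfolded Ut_eq_def]])
  then show ?thesis by (simp add: nc_subst_diff)
qed

end

section \<open>Evaluation on generators and of series in commuting arguments\<close>

lemma nc_coeff_generators_Nil [simp]:
  "nc_coeff (t1 i :: (tgen, 'k :: field_char_0) ncfps) [] = 0"
  "nc_coeff (tij N a i j :: (tgen, 'k) ncfps) [] = 0"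
  "nc_coeff (tsum N i j :: (tgen, 'k) ncfps) [] = 0"
  "nc_coeff (gA :: (gen3, 'k) ncfps) [] = 0"
  "nc_coeff (gB N a :: (gen3, 'k) ncfps) [] = 0"
  by (simp_all add: t1_def tij_def tsum_def gA_def gB_def)

lemma in_tgens:
  "i \<in> {2..n} \<Longrightarrow> T1 i \<in> tgens n N"
  "\<lbrakk>a \<in> {0..<int N}; i \<in> {2..n}; j \<in> {2..n}; i \<noteq> j\<rbrakk> \<Longrightarrow> T a i j \<in> tgens n N"
  by (simp_all add: tgens_def)

lemma nc_subst_generators:
  fixes s :: "tgen \<Rightarrow> ('y, 'k :: field_char_0) ncfps"
  assumes "\<And>x. nc_coeff (s x) [] = 0" "N > 0"
  shows "i \<in> {2..n} \<Longrightarrow> nc_subst (tgens n N) s (t1 i) = s (T1 i)"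
    and "\<lbrakk>i \<in> {2..n}; j \<in> {2..n}; i \<noteq> j\<rbrakk> \<Longrightarrow>
      nc_subst (tgens n N) s (tij N a i j) = s (T (a mod int N) i j)"
    and "\<lbrakk>i \<in> {2..n}; j \<in> {2..n}; i \<noteq> j\<rbrakk> \<Longrightarrow>
      nc_subst (tgens n N) s (tsum N i j) = (\<Sum>c = 0..<int N. s (T (c mod int N) i j))"
  using assms
  by (simp_all add: t1_def tij_def tsum_def nc_subst_sum nc_subst_letter in_tgens)

lemma nc_subst_sub:
  fixes s :: "tgen \<Rightarrow> ('y, 'k :: field_char_0) ncfps"
  assumes "\<And>x. nc_coeff (s x) [] = 0" "nc_coeff X [] = 0" "\<And>a. nc_coeff (Y a) [] = 0"
  shows "nc_subst (tgens n N) s (sub M x X Y) =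
    sub M x (nc_subst (tgens n N) s X) (\<lambda>a. nc_subst (tgens n N) s (Y a))"
proof -
  have "nc_coeff (case_gen3 X Y z) [] = 0" for z
    using assms by (cases z) simp_all
  then have "nc_subst (tgens n N) s (sub M x X Y) =
      nc_subst (gens3 M) (\<lambda>z. nc_subst (tgens n N) s (case_gen3 X Y z)) x"
    using assms(1) unfolding sub_def by (intro nc_subst_subst) simp_all
  also have "\<dots> = sub M x (nc_subst (tgens n N) s X) (\<lambda>a. nc_subst (tgens n N) s (Y a))"
    unfolding sub_def by (intro nc_subst_cong) (simp split: gen3.split)
  finally show ?thesis .
qed

text \<open>Only the letters in \<open>gens3 N\<close> are read, so \<open>Y\<close> matters only on
  the chosen representatives of the residues.\<close>

lemma sub_cong:
  assumes "X = X'" "\<And>a. a \<in> {0..<int N} \<Longrightarrow> Y a = Y' a"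
  shows "sub N x X Y = sub N x X' Y'"
  using assms unfolding sub_def by (intro nc_subst_cong) (auto simp: gens3_def)

lemma sum_gens3: "(\<Sum>x\<in>gens3 N. F x) = F LA + (\<Sum>a = 0..<int N. F (LB a))"
proof -
  have "(\<Sum>x\<in>LB ` {0..<int N}. F x) = (\<Sum>a = 0..<int N. F (LB a))"
    by (subst sum.reindex) (simp_all add: inj_on_def)
  then show ?thesis by (simp add: gens3_def image_iff)
qed

text \<open>Brings \<open>sub\<close> with proportional arguments into the form of the two
  evaluation results for commuting values.\<close>

lemma sub_commuting:
  "sub N x (c \<cdot> y) (\<lambda>a. d a \<cdot> y) = nc_subst (gens3 N) (\<lambda>z. case_gen3 c d z \<cdot> y) x"
  unfolding sub_def by (rule nc_subst_cong) (simp split: gen3.split)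

lemma sub_lie_commuting:
  assumes "nc_coeff y [] = 0" "x \<in> t03 N"
  shows "sub N x (c \<cdot> y) (\<lambda>a. d a \<cdot> y) =
    (nc_coeff x [LA] * c + (\<Sum>a = 0..<int N. nc_coeff x [LB a] * d a)) \<cdot> y"
  using assms by (simp add: sub_commuting nc_subst_lie_commuting t03_def sum_gens3)

lemma sub_grouplike_commuting:
  assumes "x \<in> Exp_t03 N"
  shows "sub N x (c \<cdot> y) (\<lambda>a. d a \<cdot> y) =
    nc_exp ((nc_coeff x [LA] * c + (\<Sum>a = 0..<int N. nc_coeff x [LB a] * d a)) \<cdot> y)"
  using assms by (simp add: sub_commuting nc_subst_grouplike_commuting Exp_t03_def sum_gens3)

lemma lie_smul: "lie (a \<cdot> f) (b \<cdot> g) = (a * b) \<cdot> lie f (g :: ('x, 'k :: comm_ring_1) ncfps)"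
proof -
  have "c \<cdot> (u - v) = c \<cdot> u - c \<cdot> v" for c and u v :: "('x, 'k) ncfps"
    by (rule ncfps_eqI) (simp add: algebra_simps)
  then show ?thesis by (simp add: lie_def nc_smul_mult mult.commute[of b a])
qed

lemma lie_self [simp]: "lie x x = 0"
  by (simp add: lie_def)


section \<open>Removing the first strand\<close>

text \<open>
  Setting \<open>t\<^sup>1\<^sup>i = 0\<close> and identifying the strands 2, 3, 4 with the three strands of the quotient of
  \<open>t\<^sub>3\<close> by its centre, which is free on \<open>A = t\<^sup>2\<^sup>3\<close> and \<open>B = t\<^sup>3\<^sup>4\<close>. The generators \<open>t(a)\<^sup>i\<^sup>j\<close> with \<open>d\<close> not
  dividing \<open>a\<close> are killed.
\<close>

definition edge :: "nat \<Rightarrow> nat \<Rightarrow> (gen3, 'k :: field_char_0) ncfps" where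
  "edge i j = (if {i, j} = {2, 3} then gA else if {i, j} = {3, 4} then gB 1 0 else - gA - gB 1 0)"

definition drop_strand :: "nat \<Rightarrow> tgen \<Rightarrow> (gen3, 'k :: field_char_0) ncfps" where
  "drop_strand d x = (case x of T1 i \<Rightarrow> 0 | T a i j \<Rightarrow> of_bool (int d dvd a) \<cdot> edge i j)"

lemma drop_strand_simps [simp]:
  "drop_strand d (T1 i) = 0"
  "drop_strand d (T a i j) = of_bool (int d dvd a) \<cdot> edge i j"
  by (simp_all add: drop_strand_def)

lemma edge_simps [simp]:
  "edge 2 3 = gA" "edge 3 4 = gB 1 0" "edge 2 4 = - gA - gB 1 0"
  by (simp_all add: edge_def doubleton_eq_iff)

lemma edge_commute: "edge i j = edge j i"
  by (simp add: edge_def insert_commute)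

text \<open>The three edges sum to 0: their sum is the central element of \<open>t\<^sub>3\<close>,
  which has been killed.\<close>

lemma edge_sum:
  assumes "{i, j, k} \<subseteq> {2..4}" "distinct [i, j, k]"
  shows "edge i k + edge j k = - edge i j"
proof -
  have "i = 2 \<or> i = 3 \<or> i = 4" "j = 2 \<or> j = 3 \<or> j = 4" "k = 2 \<or> k = 3 \<or> k = 4"
    using assms(1) by auto
  then show ?thesis
    using assms(2)
      edge_commute[of 3 2, where ?'a = 'a] edge_commute[of 4 2, where ?'a = 'a]
      edge_commute[of 4 3, where ?'a = 'a]
    by (elim disjE) simp_all
qed

lemma nc_coeff_drop_strand_Nil [simp]: "nc_coeff (drop_strand d x) [] = 0"
  by (cases x) (simp_all add: edge_def)

text \<open>Since \<open>d\<close> divides \<open>N\<close>, divisibility by \<open>d\<close> does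
  not change when \<open>a\<close> is replaced by its representative
  \<open>a mod int N\<close>.\<close>

lemma drop_strand_tij:
  assumes "N > 0" "d dvd N" "i \<in> {2..n}" "j \<in> {2..n}" "i \<noteq> j"
  shows "nc_subst (tgens n N) (drop_strand d) (tij N a i j) = of_bool (int d dvd a) \<cdot> edge i j"
  using assms by (simp add: nc_subst_generators dvd_mod_iff)

lemma drop_strand_tsum:
  assumes "N > 0" "d dvd N" "i \<in> {2..n}" "j \<in> {2..n}" "i \<noteq> j"
  shows "nc_subst (tgens n N) (drop_strand d) (tsum N i j) =
    (\<Sum>c = 0..<int N. of_bool (int d dvd c)) \<cdot> edge i j"
  using assms
  by (intro ncfps_eqI) (simp add: nc_subst_generators dvd_mod_iff sum_distrib_right del: sum_of_bool_eq)

lemma drop_strand_trels: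
  assumes N: "N > 0" "d dvd N" and r: "r \<in> trels 4 N"
  shows "nc_subst (tgens 4 N) (drop_strand d) r = (0 :: (gen3, 'k :: field_char_0) ncfps)"
proof -
  let ?F = "nc_subst (tgens 4 N) (drop_strand d) :: _ \<Rightarrow> (gen3, 'k) ncfps"
  have F_lie: "?F (lie f g) = lie (?F f) (?F g)" for f g
    by (simp add: nc_subst_lie)
  have F_t1: "?F (t1 i) = 0" if "i \<in> {2..4}" for i
    using that N by (simp add: nc_subst_generators)
  note F = F_lie F_t1 nc_subst_add nc_subst_diff drop_strand_tij[OF N] drop_strand_tsum[OF N]
  show ?thesis
    using r unfolding trels_def Un_iff mem_Collect_eq
  proof (elim disjE exE conjE, goal_cases)
    case (1 a i j)
    then show ?case by (simp add: F edge_commute[of j i])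
  next
    \<comment> \<open>If \<open>d\<close> does not divide \<open>a\<close>, the first entry is 0.
      Otherwise \<open>a + b\<close> and \<open>b\<close> have the same indicator \<open>c\<close>,
      and by \<open>edge_sum\<close> both entries are multiples of \<open>edge i j\<close>.\<close>
    case (2 a b i j k)
    have "int d dvd a + b \<longleftrightarrow> int d dvd b" if "int d dvd a"
      using that by (simp add: dvd_add_right_iff)
    moreover have "lie (edge i j) (c \<cdot> edge i k + c \<cdot> edge j k) = (0 :: (gen3, 'k) ncfps)" for c
    proof -
      have "c \<cdot> edge i k + c \<cdot> edge j k = (c \<cdot> (edge i k + edge j k) :: (gen3, 'k) ncfps)"
        by (rule ncfps_eqI) (simp add: algebra_simps)
      also have "\<dots> = (- c) \<cdot> edge i j"
        unfolding edge_sum[OF 2(2,3)] by (rule ncfps_eqI) simp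
      finally show ?thesis
        using lie_smul[of 1 "edge i j :: (gen3, 'k) ncfps" "- c" "edge i j"] by simp
    qed
    ultimately show ?case using 2 by (simp add: F)
  next
    case (3 a i j)
    then show ?case by (simp add: F lie_smul)
  next
    case (4 i j)
    then show ?case by (simp add: F)
  next
    case (5 a i j k)
    then show ?case by (simp add: F)
  next
    \<comment> \<open>Vacuous: four distinct strands do not fit into \<open>{2..4}\<close>.\<close>
    case (6 a b i j k l)
    then have "card {i, j, k, l} \<le> card {2..4 :: nat}"
      by (intro card_mono) auto
    then show ?case using 6 by simp
  qed
qed

text \<open>The five factors of the mixed pentagon, in their order. Vanishing arguments are written
  \<open>0 \<cdot> gB 1 0\<close> or \<open>0 \<cdot> gA\<close> so that the first, fourth and fifth
  factors match the evaluation results for commuting arguments.\<close>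

lemma drop_strand_sub:
  fixes x :: "(gen3, 'k :: field_char_0) ncfps"
  defines "e d \<equiv> (\<lambda>a. of_bool (int d dvd a) :: 'k)"
  assumes N: "N > 0" "d dvd N"
  shows "nc_subst (tgens 4 N) (drop_strand d) (sub N x (t1 2) (\<lambda>a. tij N a 2 3 + tij N a 2 4)) =
      sub N x (0 \<cdot> gB 1 0) (\<lambda>a. (- e d a) \<cdot> gB 1 0)"
    and "nc_subst (tgens 4 N) (drop_strand d) (sub N x (t1 3 + tsum N 2 3) (\<lambda>a. tij N a 3 4)) =
      sub N x ((\<Sum>c = 0..<int N. e d c) \<cdot> gA) (\<lambda>a. e d a \<cdot> gB 1 0)"
    and "nc_subst (tgens 4 N) (drop_strand d) (sub2 x (tij N 0 2 3) (tij N 0 3 4)) =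
      sub2 x gA (gB 1 0)"
    and "nc_subst (tgens 4 N) (drop_strand d)
        (sub N x (t1 2 + t1 3 + tsum N 2 3) (\<lambda>a. tij N a 2 4 + tij N a 3 4)) =
      sub N x ((\<Sum>c = 0..<int N. e d c) \<cdot> gA) (\<lambda>a. (- e d a) \<cdot> gA)"
    and "nc_subst (tgens 4 N) (drop_strand d) (sub N x (t1 2) (\<lambda>a. tij N a 2 3)) =
      sub N x (0 \<cdot> gA) (\<lambda>a. e d a \<cdot> gA)"
proof -
  note F = nc_subst_sub nc_subst_add drop_strand_tij[OF N] drop_strand_tsum[OF N] nc_subst_generators(1)
  \<comment> \<open>The images of \<open>t(a)\<^sup>2\<^sup>3 + t(a)\<^sup>2\<^sup>4\<close> and
    \<open>t(a)\<^sup>2\<^sup>4 + t(a)\<^sup>3\<^sup>4\<close>: each is minus the third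
    edge.\<close>
  have "b \<cdot> gA + b \<cdot> (- gA - gB 1 0) = (- b) \<cdot> gB 1 0"
    "b \<cdot> (- gA - gB 1 0) + b \<cdot> gB 1 0 = (- b) \<cdot> gA" for b :: 'k
    by (rule ncfps_eqI, simp add: algebra_simps)+
  note F = F this
  show "nc_subst (tgens 4 N) (drop_strand d) (sub N x (t1 2) (\<lambda>a. tij N a 2 3 + tij N a 2 4)) =
      sub N x (0 \<cdot> gB 1 0) (\<lambda>a. (- e d a) \<cdot> gB 1 0)"
    using N by (simp add: F e_def del: One_nat_def)
  show "nc_subst (tgens 4 N) (drop_strand d) (sub N x (t1 3 + tsum N 2 3) (\<lambda>a. tij N a 3 4)) =
      sub N x ((\<Sum>c = 0..<int N. e d c) \<cdot> gA) (\<lambda>a. e d a \<cdot> gB 1 0)"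
    using N by (simp add: F e_def del: One_nat_def)
  show "nc_subst (tgens 4 N) (drop_strand d) (sub2 x (tij N 0 2 3) (tij N 0 3 4)) =
      sub2 x gA (gB 1 0)"
    using N by (simp add: F sub2_def)
  show "nc_subst (tgens 4 N) (drop_strand d)
        (sub N x (t1 2 + t1 3 + tsum N 2 3) (\<lambda>a. tij N a 2 4 + tij N a 3 4)) =
      sub N x ((\<Sum>c = 0..<int N. e d c) \<cdot> gA) (\<lambda>a. (- e d a) \<cdot> gA)"
    using N by (simp add: F e_def del: One_nat_def)
  show "nc_subst (tgens 4 N) (drop_strand d) (sub N x (t1 2) (\<lambda>a. tij N a 2 3)) =
      sub N x (0 \<cdot> gA) (\<lambda>a. e d a \<cdot> gA)"
    using N by (simp add: F e_def del: One_nat_def)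
qed


section \<open>Vanishing of the coefficient of \<open>A\<close>\<close>

definition only_t12 :: "tgen \<Rightarrow> (gen3, 'k :: field_char_0) ncfps" where
  "only_t12 x = (if x = T1 2 then gA else 0)"

lemma nc_coeff_only_t12_Nil [simp]: "nc_coeff (only_t12 x) [] = 0"
  by (simp add: only_t12_def)

lemma only_t12_generators:
  assumes "N > 0" "i \<in> {2..n}"
  shows "nc_subst (tgens n N) only_t12 (t1 i) = (if i = 2 then gA else 0)"
    and "j \<in> {2..n} \<Longrightarrow> i \<noteq> j \<Longrightarrow> nc_subst (tgens n N) only_t12 (tij N a i j) = 0"
    and "j \<in> {2..n} \<Longrightarrow> i \<noteq> j \<Longrightarrow> nc_subst (tgens n N) only_t12 (tsum N i j) = 0"
  using assms by (simp_all add: nc_subst_generators) (simp_all add: only_t12_def)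

text \<open>In every bracket one entry is sent to 0; for
  \<open>lie (t1 i) (t1 j + tsum N i j)\<close> this is because \<open>i\<close> and
  \<open>j\<close> cannot both be 2.\<close>

lemma only_t12_trels:
  assumes N: "N > 0" and r: "r \<in> trels 4 N"
  shows "nc_subst (tgens 4 N) only_t12 r = (0 :: (gen3, 'k :: field_char_0) ncfps)"
  using r unfolding trels_def Un_iff mem_Collect_eq
  by (elim disjE exE conjE)
     (use N in \<open>simp_all add: nc_subst_diff nc_subst_lie nc_subst_add only_t12_generators\<close>)

lemma only_t12_sub:
  fixes x :: "(gen3, 'k :: field_char_0) ncfps"
  assumes "N > 0"
  shows "nc_subst (tgens 4 N) only_t12 (sub N x (t1 2) (\<lambda>a. tij N a 2 3 + tij N a 2 4)) =
      sub N x (1 \<cdot> gA) (\<lambda>_. 0 \<cdot> gA)"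
    and "nc_subst (tgens 4 N) only_t12 (sub N x (t1 3 + tsum N 2 3) (\<lambda>a. tij N a 3 4)) =
      sub N x (0 \<cdot> gA) (\<lambda>_. 0 \<cdot> gA)"
    and "nc_subst (tgens 4 N) only_t12 (sub2 x (tij N 0 2 3) (tij N 0 3 4)) =
      sub 1 x (0 \<cdot> gA) (\<lambda>_. 0 \<cdot> gA)"
    and "nc_subst (tgens 4 N) only_t12
        (sub N x (t1 2 + t1 3 + tsum N 2 3) (\<lambda>a. tij N a 2 4 + tij N a 3 4)) =
      sub N x (1 \<cdot> gA) (\<lambda>_. 0 \<cdot> gA)"
    and "nc_subst (tgens 4 N) only_t12 (sub N x (t1 2) (\<lambda>a. tij N a 2 3)) =
      sub N x (1 \<cdot> gA) (\<lambda>_. 0 \<cdot> gA)"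
  using assms by (simp_all add: nc_subst_sub nc_subst_add only_t12_generators sub2_def)

lemma nc_coeff_mult_letter:
  "nc_coeff (f * g) [x] = nc_coeff f [] * nc_coeff g [x] + nc_coeff f [x] * nc_coeff g []"
  by (simp add: times_ncfps.rep_eq)

section \<open>Consequences of the mixed pentagon for Lie series\<close>

context
  fixes N :: nat and \<phi> \<psi> :: "(gen3, 'k :: field_char_0) ncfps"
  assumes N: "N > 0" and \<phi>: "\<phi> \<in> t03 1" and \<psi>: "\<psi> \<in> t03 N"
    and pentagon: "t_eq 4 N
      (sub N \<psi> (t1 2) (\<lambda>a. tij N a 2 3 + tij N a 2 4) + sub N \<psi> (t1 3 + tsum N 2 3) (\<lambda>a. tij N a 3 4))
      (sub2 \<phi> (tij N 0 2 3) (tij N 0 3 4)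
        + sub N \<psi> (t1 2 + t1 3 + tsum N 2 3) (\<lambda>a. tij N a 2 4 + tij N a 3 4)
        + sub N \<psi> (t1 2) (\<lambda>a. tij N a 2 3))"
begin

text \<open>With \<open>a\<close> the coefficient in question, the pentagon becomes
  \<open>a A = a A + a A\<close>.\<close>

lemma lie_mixed_pentagon_coeff_A: "nc_coeff \<psi> [LA] = 0"
proof -
  have "sub N \<psi> (1 \<cdot> gA) (\<lambda>_. 0 \<cdot> gA) + sub N \<psi> (0 \<cdot> gA) (\<lambda>_. 0 \<cdot> gA) =
      sub 1 \<phi> (0 \<cdot> gA) (\<lambda>_. 0 \<cdot> gA) + sub N \<psi> (1 \<cdot> gA) (\<lambda>_. 0 \<cdot> gA)
        + sub N \<psi> (1 \<cdot> gA) (\<lambda>_. 0 \<cdot> (gA :: (gen3, 'k) ncfps))"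
    using nc_subst_t_eq[OF nc_coeff_only_t12_Nil only_t12_trels[OF N] pentagon]
    unfolding nc_subst_add only_t12_sub[OF N] .
  moreover have "sub N \<psi> (1 \<cdot> gA) (\<lambda>_. 0 \<cdot> gA) = nc_coeff \<psi> [LA] \<cdot> gA"
    "sub N \<psi> (0 \<cdot> gA) (\<lambda>_. 0 \<cdot> gA) = (0 :: (gen3, 'k) ncfps)"
    "sub 1 \<phi> (0 \<cdot> gA) (\<lambda>_. 0 \<cdot> gA) = (0 :: (gen3, 'k) ncfps)"
    unfolding sub_lie_commuting[OF nc_coeff_generators_Nil(4) \<psi>]
      sub_lie_commuting[OF nc_coeff_generators_Nil(4) \<phi>] by simp_all
  ultimately have "nc_coeff \<psi> [LA] \<cdot> gA = (0 :: (gen3, 'k) ncfps)"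
    by simp
  then have "nc_coeff (nc_coeff \<psi> [LA] \<cdot> gA :: (gen3, 'k) ncfps) [LA] = 0"
    by simp
  then show ?thesis by (simp add: gA_def)
qed

text \<open>With \<open>S\<close> the sum on the right, the image of the pentagon is
  \<open>- S B + \<psi>(m A | e\<^sub>a B) = \<phi>(A, B) - S A + S A\<close>, and the terms in
  \<open>A\<close> cancel.\<close>

lemma lie_mixed_pentagon_drop_strand:
  assumes d: "d dvd N"
  shows "sub N \<psi> ((\<Sum>c = 0..<int N. of_bool (int d dvd c)) \<cdot> gA) (\<lambda>a. of_bool (int d dvd a) \<cdot> gB 1 0) =
    sub2 \<phi> gA (gB 1 0) + (\<Sum>a = 0..<int N. nc_coeff \<psi> [LB a] * of_bool (int d dvd a)) \<cdot> gB 1 0"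
proof -
  define S where "S = (\<Sum>a = 0..<int N. nc_coeff \<psi> [LB a] * of_bool (int d dvd a))"
  have "sub N \<psi> (c \<cdot> y) (\<lambda>a. of_bool (int d dvd a) \<cdot> y) = S \<cdot> y"
    "sub N \<psi> (c \<cdot> y) (\<lambda>a. (- of_bool (int d dvd a)) \<cdot> y) = (- S) \<cdot> y"
    if "nc_coeff y [] = 0" for c and y :: "(gen3, 'k) ncfps"
    by (simp_all only: sub_lie_commuting[OF that \<psi>] lie_mixed_pentagon_coeff_A S_def
        mult_minus_right sum_negf mult_zero_left add_0_left)
  then have "(- S) \<cdot> gB 1 0 +
      sub N \<psi> ((\<Sum>c = 0..<int N. of_bool (int d dvd c)) \<cdot> gA) (\<lambda>a. of_bool (int d dvd a) \<cdot> gB 1 0) =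
      sub2 \<phi> gA (gB 1 0) + (- S) \<cdot> gA + S \<cdot> gA"
    using nc_subst_t_eq[OF nc_coeff_drop_strand_Nil drop_strand_trels[OF N d] pentagon]
    unfolding nc_subst_add drop_strand_sub[OF N d] by (simp only: nc_coeff_generators_Nil)
  moreover have "(- S) \<cdot> y = - (S \<cdot> y)" for y :: "(gen3, 'k) ncfps"
    by (rule ncfps_eqI) simp
  ultimately show ?thesis unfolding S_def by (simp add: algebra_simps)
qed

end

section \<open>Consequences of the mixed pentagon for grouplike series\<close>

context
  fixes N :: nat and g h :: "(gen3, 'k :: field_char_0) ncfps"
  assumes N: "N > 0" and g: "g \<in> Exp_t03 1" and h: "h \<in> Exp_t03 N"
    and pentagon: "mixed_pentagon N g h"
begin

text \<open>With \<open>E\<close> the exponential of \<open>a A\<close>, where \<open>a\<close> is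
  the coefficient in question, the pentagon becomes \<open>E = E * E\<close>; comparing coefficients
  of \<open>A\<close> gives \<open>a = a + a\<close>.\<close>

lemma mixed_pentagon_coeff_A: "nc_coeff h [LA] = 0"
proof -
  let ?h = "nc_exp (nc_coeff h [LA] \<cdot> gA) :: (gen3, 'k) ncfps"
  have "sub N h (1 \<cdot> gA) (\<lambda>_. 0 \<cdot> gA) * sub N h (0 \<cdot> gA) (\<lambda>_. 0 \<cdot> gA) =
      sub 1 g (0 \<cdot> gA) (\<lambda>_. 0 \<cdot> gA) * sub N h (1 \<cdot> gA) (\<lambda>_. 0 \<cdot> gA)
        * sub N h (1 \<cdot> gA) (\<lambda>_. 0 \<cdot> (gA :: (gen3, 'k) ncfps))"
    using nc_subst_Ut_eq[OF nc_coeff_only_t12_Nil only_t12_trels[OF N]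
        pentagon[unfolded mixed_pentagon_def Let_def]]
    unfolding nc_subst_mult[OF finite_tgens nc_coeff_only_t12_Nil] only_t12_sub[OF N] .
  moreover have "sub N h (1 \<cdot> gA) (\<lambda>_. 0 \<cdot> gA) = ?h"
    "sub N h (0 \<cdot> gA) (\<lambda>_. 0 \<cdot> gA) = (1 :: (gen3, 'k) ncfps)"
    "sub 1 g (0 \<cdot> gA) (\<lambda>_. 0 \<cdot> gA) = (1 :: (gen3, 'k) ncfps)"
    unfolding sub_grouplike_commuting[OF h] sub_grouplike_commuting[OF g] by simp_all
  ultimately have "?h = ?h * ?h" by simp
  then have "nc_coeff ?h [LA] = nc_coeff (?h * ?h) [LA]" by simp
  then show ?thesis
    by (simp add: nc_coeff_mult_letter nc_coeff_exp gA_def)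
qed

text \<open>The last two factors of the image are exponentials of \<open>- S A\<close> and
  \<open>S A\<close> and cancel. The exponential of \<open>- S B\<close> stands leftmost, so
  inverting it leaves the correction on the left, as in \<open>group_distribution\<close>.\<close>

lemma mixed_pentagon_drop_strand:
  assumes d: "d dvd N"
  shows "sub N h ((\<Sum>c = 0..<int N. of_bool (int d dvd c)) \<cdot> gA) (\<lambda>a. of_bool (int d dvd a) \<cdot> gB 1 0) =
    nc_exp ((\<Sum>a = 0..<int N. nc_coeff h [LB a] * of_bool (int d dvd a)) \<cdot> gB 1 0) * sub2 g gA (gB 1 0)"
    (is "?lhs = _")
proof -
  define S where "S = (\<Sum>a = 0..<int N. nc_coeff h [LB a] * of_bool (int d dvd a))"
  have "sub N h (c \<cdot> y) (\<lambda>a. of_bool (int d dvd a) \<cdot> y) = nc_exp (S \<cdot> y)"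
    "sub N h (c \<cdot> y) (\<lambda>a. (- of_bool (int d dvd a)) \<cdot> y) = nc_exp ((- S) \<cdot> y)"
    for c and y :: "(gen3, 'k) ncfps"
    by (simp_all only: sub_grouplike_commuting[OF h] mixed_pentagon_coeff_A S_def
        mult_minus_right sum_negf mult_zero_left add_0_left)
  then have "nc_exp ((- S) \<cdot> gB 1 0) * ?lhs =
      sub2 g gA (gB 1 0) * nc_exp ((- S) \<cdot> gA) * nc_exp (S \<cdot> gA)"
    using nc_subst_Ut_eq[OF nc_coeff_drop_strand_Nil drop_strand_trels[OF N d]
        pentagon[unfolded mixed_pentagon_def Let_def]]
    unfolding nc_subst_mult[OF finite_tgens nc_coeff_drop_strand_Nil] drop_strand_sub[OF N d]
    by (simp only:)
  also have "\<dots> = sub2 g gA (gB 1 0)"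
    by (simp add: mult.assoc nc_exp_smul_add)
  finally have "nc_exp (S \<cdot> gB 1 0) * (nc_exp ((- S) \<cdot> gB 1 0) * ?lhs) =
      nc_exp (S \<cdot> gB 1 0) * sub2 g gA (gB 1 0)"
    by simp
  then show ?thesis
    unfolding S_def[symmetric] by (simp add: mult.assoc[symmetric] nc_exp_smul_add)
qed

end


section \<open>Distribution\<close>

text \<open>The case \<open>d = 1\<close> of the strand removal: every residue survives and the
  factor of \<open>A\<close> is the number \<open>N\<close> of residues.\<close>

lemma pi_map_1:
  "pi_map N 1 x =
    sub N x ((\<Sum>c = 0..<int N. of_bool (int 1 dvd c)) \<cdot> gA) (\<lambda>a. of_bool (int 1 dvd a) \<cdot> gB 1 0)"
  unfolding pi_map_def by (rule sub_cong) (simp_all add: gB_def)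

lemma int_dvd_iff_eq_0:
  assumes "a \<in> {0..<int N}"
  shows "int N dvd a \<longleftrightarrow> a = 0"
  using assms by (cases "a = 0") (auto dest: zdvd_imp_le)

lemma sum_dvd:
  fixes f :: "int \<Rightarrow> 'k :: ring_1"
  assumes "N > 0"
  shows "(\<Sum>a = 0..<int N. f a * of_bool (int N dvd a)) = f 0"
proof -
  have "(\<Sum>a = 0..<int N. f a * of_bool (int N dvd a)) = (\<Sum>a = 0..<int N. if a = 0 then f a else 0)"
    by (rule sum.cong) (simp_all add: int_dvd_iff_eq_0)
  then show ?thesis using assms by simp
qed

text \<open>The case \<open>d = N\<close> of the strand removal: only the residue 0 survives, so the
  factor of \<open>A\<close> is 1.\<close>

lemma delta_map_1:
  assumes "N > 0"
  shows "delta_map N 1 x =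
    sub N x ((\<Sum>c = 0..<int N. of_bool (int N dvd c)) \<cdot> gA) (\<lambda>a. of_bool (int N dvd a) \<cdot> gB 1 0)"
proof -
  have "(\<Sum>c = 0..<int N. of_bool (int N dvd c)) = (1 :: 'a)"
    using sum_dvd[OF assms, of "\<lambda>_. 1 :: 'a"] by (simp only: mult_1_left)
  then show ?thesis
    unfolding delta_map_def Let_def
    by (intro sub_cong) (simp_all add: gB_def)
qed

lemma rho_1: "rho N 1 x = (\<Sum>a = 0..<int N. nc_coeff x [LB a]) - nc_coeff x [LB 0]"
proof -
  have "coeff_B0 (pi_map N 1 x) = (\<Sum>a = 0..<int N. nc_coeff x [LB a])"
    unfolding pi_map_def sub_def coeff_B0_def
    by (simp add: nc_coeff_subst_letter sum_gens3 gA_def gB_def)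
  then show ?thesis by (simp add: rho_def coeff_B0_def)
qed

text \<open>For \<open>N' = N\<close> the quotient is 1, and both maps send each generator to
  itself.\<close>

lemma distribution_refl:
  assumes "N > 0"
  shows "pi_map N N x = delta_map N N x" and "rho N N x = 0"
proof -
  show "pi_map N N x = delta_map N N x"
    using assms by (simp add: pi_map_def delta_map_def)
  have "coeff_B0 (pi_map N N x) =
      (\<Sum>a = 0..<int N. nc_coeff x [LB a] * nc_coeff (gB N a) [LB 0])"
    unfolding pi_map_def sub_def coeff_B0_def
    by (simp add: nc_coeff_subst_letter sum_gens3 gA_def)
  also have "\<dots> = (\<Sum>a = 0..<int N. if a = 0 then nc_coeff x [LB a] else 0)"
    by (rule sum.cong) (simp_all add: gB_def)
  finally have "coeff_B0 (pi_map N N x) = nc_coeff x [LB 0]"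
    using assms by simp
  then show "rho N N x = 0"
    by (simp add: rho_def coeff_B0_def)
qed

text \<open>Both images are \<open>\<phi>(A, B)\<close> plus a multiple of \<open>B\<close>. For
  \<open>d = 1\<close> the multiple is the sum of all coefficients of the \<open>B(a)\<close>; for
  \<open>d = N\<close> it is the coefficient of \<open>B(0)\<close>, which is 0 by normalisation.
  Their difference is \<open>rho\<close>.\<close>

lemma grtm_distribution_1:
  assumes N: "N > 0" and "(\<phi>, \<psi>) \<in> grtm N"
  shows "pi_map N 1 \<psi> - delta_map N 1 \<psi> = rho N 1 \<psi> \<cdot> gB 1 0"
proof -
  have "\<phi> \<in> t03 1" "\<psi> \<in> t03 N" and B0: "nc_coeff \<psi> [LB 0] = 0"
    and pentagon: "t_eq 4 N
      (sub N \<psi> (t1 2) (\<lambda>a. tij N a 2 3 + tij N a 2 4) + sub N \<psi> (t1 3 + tsum N 2 3) (\<lambda>a. tij N a 3 4))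
      (sub2 \<phi> (tij N 0 2 3) (tij N 0 3 4)
        + sub N \<psi> (t1 2 + t1 3 + tsum N 2 3) (\<lambda>a. tij N a 2 4 + tij N a 3 4)
        + sub N \<psi> (t1 2) (\<lambda>a. tij N a 2 3))"
    using assms(2) by (auto simp: grtm_def grt1_def coeff_B0_def Let_def)
  note drop = lie_mixed_pentagon_drop_strand[OF N this(1,2) pentagon]
  have "pi_map N 1 \<psi> = sub2 \<phi> gA (gB 1 0) + (\<Sum>a = 0..<int N. nc_coeff \<psi> [LB a]) \<cdot> gB 1 0"
    unfolding pi_map_1 using drop[of 1] by simp
  moreover have "delta_map N 1 \<psi> = sub2 \<phi> gA (gB 1 0)"
    unfolding delta_map_1[OF N] drop[OF dvd_refl] sum_dvd[OF N] B0 by simp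
  ultimately show ?thesis by (simp add: rho_1[simplified] B0)
qed

lemma mixed_pentagon_distribution_1:
  assumes N: "N > 0" and "g \<in> Exp_t03 1" "h \<in> Exp_t03 N" "mixed_pentagon N g h"
    and B0: "coeff_B0 h = 0"
  shows "pi_map N 1 h = nc_exp (rho N 1 h \<cdot> gB 1 0) * delta_map N 1 h"
proof -
  note drop = mixed_pentagon_drop_strand[OF assms(1-4)]
  have B0: "nc_coeff h [LB 0] = 0" using B0 by (simp add: coeff_B0_def)
  have "pi_map N 1 h = nc_exp ((\<Sum>a = 0..<int N. nc_coeff h [LB a]) \<cdot> gB 1 0) * sub2 g gA (gB 1 0)"
    unfolding pi_map_1 using drop[of 1] by simp
  moreover have "delta_map N 1 h = sub2 g gA (gB 1 0)"
    unfolding delta_map_1[OF N] drop[OF dvd_refl] sum_dvd[OF N] B0 by simp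
  ultimately show ?thesis by (simp add: rho_1[simplified] B0)
qed

text \<open>Shared by \<open>GRTM\<close> and \<open>Pseudo\<close>. Primality leaves only the
  divisors 1 and \<open>p\<close>; for the latter the exponential factor is 1.\<close>

lemma mixed_pentagon_group_distribution:
  assumes "prime p" "g \<in> Exp_t03 1" "h \<in> Exp_t03 p" "mixed_pentagon p g h" "coeff_B0 h = 0"
  shows "group_distribution p h"
proof -
  have p: "p > 0" using \<open>prime p\<close> by (rule prime_gt_0_nat)
  have "pi_map p q h = nc_exp (rho p q h \<cdot> gB q 0) * delta_map p q h" if "q = 1 \<or> q = p" for q
    using that
  proof
    assume "q = 1"
    then show ?thesis using mixed_pentagon_distribution_1[OF p assms(2-5)] by simp
  next
    assume "q = p"
    then show ?thesis by (simp add: distribution_refl[OF p])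
  qed
  then show ?thesis
    using \<open>prime p\<close> unfolding group_distribution_def prime_nat_iff by blast
qed

theorem corollary2p11:
  fixes p :: nat
  assumes "prime p"
  shows "(grtmd p :: ((gen3, 'k :: field_char_0) ncfps \<times> (gen3, 'k) ncfps) set) = grtm p \<and>
         (GRTMD p :: ((gen3, 'k) ncfps \<times> (gen3, 'k) ncfps) set) = GRTM p \<and>
         (Psdist p :: ((gen3, 'k) ncfps \<times> (gen3, 'k) ncfps) set) = Pseudo p"
proof (intro conjI)
  have p: "p > 0" using assms by (rule prime_gt_0_nat)
  have "pi_map p q \<psi> - delta_map p q \<psi> = rho p q \<psi> \<cdot> gB q 0"
    if "(\<phi>, \<psi>) \<in> grtm p" "q dvd p" for q and \<phi> \<psi> :: "(gen3, 'k) ncfps"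
  proof -
    have "q = 1 \<or> q = p" using assms that(2) by (simp add: prime_nat_iff)
    then show ?thesis
    proof
      assume "q = 1"
      then show ?thesis using grtm_distribution_1[OF p that(1)] by simp
    next
      assume "q = p"
      then show ?thesis by (simp add: distribution_refl[OF p])
    qed
  qed
  then show "(grtmd p :: ((gen3, 'k) ncfps \<times> (gen3, 'k) ncfps) set) = grtm p"
    unfolding grtmd_def by blast
  have "group_distribution p h" if "(g, h) \<in> GRTM p" for g h :: "(gen3, 'k) ncfps"
    using that assms
    by (intro mixed_pentagon_group_distribution[of p g]) (auto simp: GRTM_def GRT1_def)
  then show "(GRTMD p :: ((gen3, 'k) ncfps \<times> (gen3, 'k) ncfps) set) = GRTM p"
    unfolding GRTMD_def by blast
  have "group_distribution p h" if "(g, h) \<in> Pseudo p" for g h :: "(gen3, 'k) ncfps"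
    using that assms
    by (intro mixed_pentagon_group_distribution[of p g]) (auto simp: Pseudo_def M1_def)
  then show "(Psdist p :: ((gen3, 'k) ncfps \<times> (gen3, 'k) ncfps) set) = Pseudo p"
    unfolding Psdist_def by blast
qed

end
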